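(* Let $M=G/K$ be a homogeneous superspace with $G$-invariant graded Riemannian metric $g$, where $G=(G_0,\mathfrak g)$ is a connected Lie supergroup, $\mathfrak g$ a compact real form of a basic classical Lie superalgebra $\mathfrak g^{\mathbb C}$, and $K=(K_0,\mathfrak k)$ a connected closed Lie subsupergroup of $G$. Let $\mathfrak m$ be a $Q$-orthogonal complement of $\mathfrak k$, where $Q$ is an $\mathrm{ad}_{\mathfrak g^{\mathbb C}}$-invariant non-degenerate supersymmetric even bilinear form on $\mathfrak g^{\mathbb C}$, and let $X_i,X_j,X_k,X_\ell\in\mathfrak m$ be homogeneous. Then, at the base point $K$, \begin{align*} 4\langle R(X_i,X_j)X_k,X_\ell\rangle =&-2\langle[X_i,X_j]_{\mathfrak m},[X_k,X_\ell]_{\mathfrak m}\rangle +(-1)^{[X_i]([X_j]+[X_k])}\langle[X_j,X_k]_{\mathfrak m},[X_i,X_\ell]_{\mathfrak m}\rangle\\ &-(-1)^{[X_j][X_k]}\langle[X_i,X_k]_{\mathfrak m},[X_j,X_\ell]_{\mathfrak m}\rangle -\langle X_i,[[X_j,X_k]_{\mathfrak m},X_\ell]_{\mathfrak m}\rangle +\langle[X_i,[X_j,X_k]_{\mathfrak m}]_{\mathfrak m},X_\ell\rangle\\ &+(-1)^{[X_i][X_j]}\langle X_j,[[X_i,X_k]_{\mathfrak m},X_\ell]_{\mathfrak m}\rangle +(-1)^{[X_j][X_k]}\langle[[X_i,X_k]_{\mathfrak m},X_j]_{\mathfrak m},X_\ell\rangle\\ &+(-1)^{[X_i]([X_j]+[X_k])}\langle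 X_j,[X_k,[X_i,X_\ell]_{\mathfrak m}]_{\mathfrak m}\rangle +(-1)^{[X_i][X_j]+[X_k][X_\ell]}\langle[X_j,[X_i,X_\ell]_{\mathfrak m}]_{\mathfrak m},X_k\rangle\\ &-(-1)^{[X_j][X_k]}\langle X_i,[X_k,[X_j,X_\ell]_{\mathfrak m}]_{\mathfrak m}\rangle -(-1)^{[X_k][X_\ell]}\langle[X_i,[X_j,X_\ell]_{\mathfrak m}]_{\mathfrak m},X_k\rangle\\ &+2\langle X_i,[X_j,[X_k,X_\ell]_{\mathfrak g}]_{\mathfrak m}\rangle -2(-1)^{[X_i][X_j]}\langle X_j,[X_i,[X_k,X_\ell]_{\mathfrak g}]_{\mathfrak m}\rangle\\ &+(-1)^{[X_i]([X_j]+[X_k])}\langle U(X_j,X_k),U(X_i,X_\ell)\rangle -(-1)^{[X_j][X_k]}\langle U(X_i,X_k),U(X_j,X_\ell)\rangle. \end{align*}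
   Context: Supermanifolds are real smooth supermanifolds; $[X]\in\mathbb Z_2$ is the parity of a homogeneous element. A Lie supergroup is identified with its Harish-Chandra pair $(G_0,\mathfrak g)$. A finite-dimensional complex Lie superalgebra is basic classical if it is simple, its even part is reductive, and it admits a non-degenerate $\mathrm{ad}$-invariant supersymmetric even bilinear form; a real form is compact if its even part is a compact Lie algebra. $\mathfrak g=\mathfrak k\oplus\mathfrak m$ with $[\mathfrak k,\mathfrak m]\subseteq\mathfrak m$; $[\cdot,\cdot]_{\mathfrak g}$ is the bracket of $\mathfrak g$ and $[\cdot,\cdot]_{\mathfrak k},[\cdot,\cdot]_{\mathfrak m}$ are its $\mathfrak k$- and $\mathfrak m$-components. A graded Riemannian metric on $M$ is a non-degenerate, supersymmetric, even $\mathcal O_M$-bilinear form on the tangent sheaf. It is $G$-invariant if $G_0$ acts by isometries and all vector fields $X^\dagger$ ($X\in\mathfrak g$) are graded Killing fields, i.e. $X^\dagger g(Y,Z)=g([X^\dagger,Y],Z)+(-1)^{[X][Y]}g(Y,[X^\dagger,Z])$, where $X\mapsto X^\dagger$ is the infinitesimal action anti-homomorphism (so $[X^\dagger,Y^\dagger]=-[X,Y]^\dagger_{\mathfrak g}$). $\mathfrak m$ is identified with $T_KM$ via $X\mapsto(X^\dagger)_K$, and $\langle\cdot,\cdot\rangle$ is the $\mathrm{ad}_{\mathfrak k}$-invariant scalar superproduct on $\mathfrak m$ induced by $g_K$. With $\nabla$ the Levi-Civita connection ($Xg(Y,Z)=g(\nabla_XY,Z)+(-1)^{[X][Y]}g(Y,\nabla_XZ)$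 and $[X,Y]=\nabla_XY-(-1)^{[X][Y]}\nabla_YX$), the Riemann curvature tensor is $R(X,Y)Z=\nabla_{[X,Y]}Z-\nabla_X\nabla_YZ+(-1)^{[X][Y]}\nabla_Y\nabla_XZ$; in the claim it is evaluated at $K$ on tangent vectors in $\mathfrak m\cong T_KM$. The even bilinear map $U:\mathfrak m\times\mathfrak m\to\mathfrak m$ is defined by $\langle U(X,Y),Z\rangle=-\langle X,[Y,Z]_{\mathfrak m}\rangle-(-1)^{[X][Y]}\langle Y,[X,Z]_{\mathfrak m}\rangle$ for $X,Y,Z\in\mathfrak m$. *)

theory Defs
  imports "HOL-Analysis.Analysis" "HOL-Algebra.Coset" "HOL-Library.Z2"
begin

section \<open>Lie superalgebras\<close>

text \<open>
  Parities are elements of the field \<^typ>\<open>bit\<close> with two elements. A \<open>\<int>\<^sub>2\<close>-grading is given by its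
  two homogeneous parts, so ``\<open>x\<close> is homogeneous of parity \<open>a\<close>'' reads \<open>x \<in> P a\<close>.
\<close>

definition psign :: "bit \<Rightarrow> 'k::ring_1" where
  "psign a = (if a = 0 then 1 else - 1)"

definition super_vector_space :: "('k::field \<Rightarrow> 'v::ab_group_add \<Rightarrow> 'v) \<Rightarrow> (bit \<Rightarrow> 'v set) \<Rightarrow> bool" where
  "super_vector_space sc P \<longleftrightarrow>
     vector_space sc \<and> (\<forall>a. module.subspace sc (P a)) \<and>
     P 0 \<inter> P 1 = {0} \<and> (\<forall>x. \<exists>y\<in>P 0. \<exists>z\<in>P 1. x = y + z)"

definition finite_dimensional :: "('k::field \<Rightarrow> 'v::ab_group_add \<Rightarrow> 'v) \<Rightarrow> bool" where
  "finite_dimensional sc \<longleftrightarrow> (\<exists>B. finite B \<and> module.span sc B = UNIV)"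

definition lie_superalgebra ::
  "('k::field \<Rightarrow> 'v::ab_group_add \<Rightarrow> 'v) \<Rightarrow> (bit \<Rightarrow> 'v set) \<Rightarrow> ('v \<Rightarrow> 'v \<Rightarrow> 'v) \<Rightarrow> bool" where
  "lie_superalgebra sc P br \<longleftrightarrow>
     super_vector_space sc P \<and>
     (\<forall>x. Vector_Spaces.linear sc sc (br x)) \<and>
     (\<forall>y. Vector_Spaces.linear sc sc (\<lambda>x. br x y)) \<and>
     (\<forall>a b. \<forall>x\<in>P a. \<forall>y\<in>P b. br x y \<in> P (a + b)) \<and>
     (\<forall>a b. \<forall>x\<in>P a. \<forall>y\<in>P b. br x y = sc (- psign (a * b)) (br y x)) \<and>
     (\<forall>a b. \<forall>x\<in>P a. \<forall>y\<in>P b. \<forall>z.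
        br x (br y z) = br (br x y) z + sc (psign (a * b)) (br y (br x z)))"

definition graded_subspace ::
  "('k::field \<Rightarrow> 'v::ab_group_add \<Rightarrow> 'v) \<Rightarrow> (bit \<Rightarrow> 'v set) \<Rightarrow> 'v set \<Rightarrow> bool" where
  "graded_subspace sc P I \<longleftrightarrow>
     module.subspace sc I \<and> (\<forall>x\<in>I. \<exists>y\<in>I \<inter> P 0. \<exists>z\<in>I \<inter> P 1. x = y + z)"

definition simple_lie_superalgebra ::
  "('k::field \<Rightarrow> 'v::ab_group_add \<Rightarrow> 'v) \<Rightarrow> (bit \<Rightarrow> 'v set) \<Rightarrow> ('v \<Rightarrow> 'v \<Rightarrow> 'v) \<Rightarrow> bool" where
  "simple_lie_superalgebra sc P br \<longleftrightarrow>
     lie_superalgebra sc P br \<and> (\<exists>x y. br x y \<noteq> 0) \<and>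
     (\<forall>I. graded_subspace sc P I \<and> (\<forall>x. \<forall>y\<in>I. br x y \<in> I) \<longrightarrow> I = {0} \<or> I = UNIV)"

text \<open>A Lie algebra is reductive if every ideal has a complementary ideal.\<close>

definition even_part_reductive ::
  "('k::field \<Rightarrow> 'v::ab_group_add \<Rightarrow> 'v) \<Rightarrow> (bit \<Rightarrow> 'v set) \<Rightarrow> ('v \<Rightarrow> 'v \<Rightarrow> 'v) \<Rightarrow> bool" where
  "even_part_reductive sc P br \<longleftrightarrow>
     (let ideal = (\<lambda>I. module.subspace sc I \<and> I \<subseteq> P 0 \<and> (\<forall>x\<in>P 0. \<forall>y\<in>I. br x y \<in> I)) in
      \<forall>I. ideal I \<longrightarrow>
        (\<exists>J. ideal J \<and> I \<inter> J = {0} \<and> (\<forall>x\<in>P 0. \<exists>y\<in>I. \<exists>z\<in>J. x = y + z)))"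

definition invariant_form ::
  "('k::field \<Rightarrow> 'v::ab_group_add \<Rightarrow> 'v) \<Rightarrow> (bit \<Rightarrow> 'v set) \<Rightarrow> ('v \<Rightarrow> 'v \<Rightarrow> 'v)
     \<Rightarrow> ('v \<Rightarrow> 'v \<Rightarrow> 'k) \<Rightarrow> bool" where
  "invariant_form sc P br Q \<longleftrightarrow>
     (\<forall>x. Vector_Spaces.linear sc (*) (Q x)) \<and>
     (\<forall>y. Vector_Spaces.linear sc (*) (\<lambda>x. Q x y)) \<and>
     (\<forall>a b. \<forall>x\<in>P a. \<forall>y\<in>P b. a \<noteq> b \<longrightarrow> Q x y = 0) \<and>
     (\<forall>a b. \<forall>x\<in>P a. \<forall>y\<in>P b. Q x y = psign (a * b) * Q y x) \<and>
     (\<forall>x. (\<forall>y. Q x y = 0) \<longrightarrow> x = 0) \<and>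
     (\<forall>x y z. Q (br x y) z = Q x (br y z))"

definition basic_classical ::
  "(complex \<Rightarrow> 'v::ab_group_add \<Rightarrow> 'v) \<Rightarrow> (bit \<Rightarrow> 'v set) \<Rightarrow> ('v \<Rightarrow> 'v \<Rightarrow> 'v) \<Rightarrow> bool" where
  "basic_classical sc P br \<longleftrightarrow>
     finite_dimensional sc \<and> simple_lie_superalgebra sc P br \<and>
     even_part_reductive sc P br \<and> (\<exists>Q. invariant_form sc P br Q)"

text \<open>The complexification of a real Lie superalgebra; the pair \<open>(x, y)\<close> stands for \<open>x + \<i>y\<close>.\<close>

definition cx_scale :: "complex \<Rightarrow> 'a::real_vector \<times> 'a \<Rightarrow> 'a \<times> 'a" where
  "cx_scale c z = (Re c *\<^sub>R fst z - Im c *\<^sub>R snd z, Re c *\<^sub>R snd z + Im c *\<^sub>R fst z)"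

definition cx_part :: "(bit \<Rightarrow> 'a set) \<Rightarrow> bit \<Rightarrow> ('a \<times> 'a) set" where
  "cx_part P a = P a \<times> P a"

definition cx_bracket :: "('a \<Rightarrow> 'a \<Rightarrow> 'a::real_vector) \<Rightarrow> 'a \<times> 'a \<Rightarrow> 'a \<times> 'a \<Rightarrow> 'a \<times> 'a" where
  "cx_bracket br z w =
     (br (fst z) (fst w) - br (snd z) (snd w), br (fst z) (snd w) + br (snd z) (fst w))"

text \<open>A real Lie algebra is compact if it admits an \<open>ad\<close>-invariant inner product.\<close>

definition compact_even_part :: "(bit \<Rightarrow> 'a::real_vector set) \<Rightarrow> ('a \<Rightarrow> 'a \<Rightarrow> 'a) \<Rightarrow> bool" where
  "compact_even_part P br \<longleftrightarrow>
     (\<exists>B :: 'a \<Rightarrow> 'a \<Rightarrow> real.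
        (\<forall>x. linear (B x)) \<and> (\<forall>y. linear (\<lambda>x. B x y)) \<and>
        (\<forall>x\<in>P 0. \<forall>y\<in>P 0. B x y = B y x) \<and> (\<forall>x\<in>P 0. x \<noteq> 0 \<longrightarrow> B x x > 0) \<and>
        (\<forall>x\<in>P 0. \<forall>y\<in>P 0. \<forall>z\<in>P 0. B (br x y) z = B x (br y z)))"


section \<open>Smooth functions and manifolds\<close>

text \<open>
  \<open>\<real>\<^sup>n\<close> is \<^const>\<open>Euclidean_space\<close>, i.e. sequences vanishing from index \<open>n\<close> on, so that the
  dimension is a number and may be \<open>0\<close>. On an open set \<open>D\<close>, a function is smooth if all its
  iterated partial derivatives exist and are continuous.
\<close>

fun Ck_on :: "nat \<Rightarrow> nat \<Rightarrow> (nat \<Rightarrow> real) set \<Rightarrow> ((nat \<Rightarrow> real) \<Rightarrow> real) \<Rightarrow> bool" where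
  "Ck_on n 0 D f = continuous_map (subtopology (Euclidean_space n) D) euclideanreal f"
| "Ck_on n (Suc r) D f =
     (continuous_map (subtopology (Euclidean_space n) D) euclideanreal f \<and>
      (\<forall>i<n. (\<forall>x\<in>D. (\<lambda>t. f (x(i := t))) differentiable (at (x i))) \<and>
             Ck_on n r D (\<lambda>x. deriv (\<lambda>t. f (x(i := t))) (x i))))"

definition smooth_on :: "nat \<Rightarrow> (nat \<Rightarrow> real) set \<Rightarrow> ((nat \<Rightarrow> real) \<Rightarrow> real) \<Rightarrow> bool" where
  "smooth_on n D f \<longleftrightarrow> (\<forall>r. Ck_on n r D f)"

text \<open>The two components of a point of \<open>\<real>\<^bsup>n+m\<^esup> = \<real>\<^sup>n \<times> \<real>\<^sup>m\<close>.\<close>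

definition fst_block :: "nat \<Rightarrow> (nat \<Rightarrow> real) \<Rightarrow> nat \<Rightarrow> real" where
  "fst_block n z = (\<lambda>i. if i < n then z i else 0)"

definition snd_block :: "nat \<Rightarrow> (nat \<Rightarrow> real) \<Rightarrow> nat \<Rightarrow> real" where
  "snd_block n z = (\<lambda>i. z (n + i))"

definition coordinate_chart :: "'p topology \<Rightarrow> nat \<Rightarrow> 'p set \<Rightarrow> ('p \<Rightarrow> nat \<Rightarrow> real) \<Rightarrow> bool" where
  "coordinate_chart T n U \<phi> \<longleftrightarrow>
     openin T U \<and> openin (Euclidean_space n) (\<phi> ` U) \<and>
     homeomorphic_map (subtopology T U) (subtopology (Euclidean_space n) (\<phi> ` U)) \<phi>"

definition smooth_manifold ::
  "'p topology \<Rightarrow> nat \<Rightarrow> ('p set \<times> ('p \<Rightarrow> nat \<Rightarrow> real)) set \<Rightarrow> bool" where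
  "smooth_manifold T n A \<longleftrightarrow>
     Hausdorff_space T \<and> second_countable T \<and> (\<Union>(U, \<phi>)\<in>A. U) = topspace T \<and>
     (\<forall>(U, \<phi>)\<in>A. coordinate_chart T n U \<phi>) \<and>
     (\<forall>(U, \<phi>)\<in>A. \<forall>(V, \<psi>)\<in>A. \<forall>i<n.
        smooth_on n (\<phi> ` (U \<inter> V)) (\<lambda>x. \<psi> (inv_into U \<phi> x) i))"


section \<open>Lie supergroups as Harish-Chandra pairs\<close>

record 'g group_manifold = "'g monoid" +
  gtop :: "'g topology"
  gdim :: nat
  atlas :: "('g set \<times> ('g \<Rightarrow> nat \<Rightarrow> real)) set"

definition smooth_functions :: "'g group_manifold \<Rightarrow> ('g \<Rightarrow> real) set" where
  "smooth_functions G =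
     {f. \<forall>(U, \<phi>)\<in>atlas G. smooth_on (gdim G) (\<phi> ` U) (\<lambda>x. f (inv_into U \<phi> x))}"

definition lie_group :: "'g group_manifold \<Rightarrow> bool" where
  "lie_group G \<longleftrightarrow>
     group G \<and> carrier G = UNIV \<and> topspace (gtop G) = UNIV \<and>
     smooth_manifold (gtop G) (gdim G) (atlas G) \<and>
     continuous_map (prod_topology (gtop G) (gtop G)) (gtop G) (\<lambda>(x, y). x \<otimes>\<^bsub>G\<^esub> y) \<and>
     continuous_map (gtop G) (gtop G) (\<lambda>x. inv\<^bsub>G\<^esub> x) \<and>
     (\<forall>(U, \<phi>)\<in>atlas G. \<forall>(V, \<psi>)\<in>atlas G. \<forall>(W, \<eta>)\<in>atlas G. \<forall>i<gdim G.
        smooth_on (gdim G + gdim G)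
          {z \<in> topspace (Euclidean_space (gdim G + gdim G)).
             fst_block (gdim G) z \<in> \<phi> ` U \<and> snd_block (gdim G) z \<in> \<psi> ` V \<and>
             inv_into U \<phi> (fst_block (gdim G) z) \<otimes>\<^bsub>G\<^esub> inv_into V \<psi> (snd_block (gdim G) z) \<in> W}
          (\<lambda>z. \<eta> (inv_into U \<phi> (fst_block (gdim G) z)
                    \<otimes>\<^bsub>G\<^esub> inv_into V \<psi> (snd_block (gdim G) z)) i)) \<and>
     (\<forall>(U, \<phi>)\<in>atlas G. \<forall>(W, \<eta>)\<in>atlas G. \<forall>i<gdim G.
        smooth_on (gdim G) (\<phi> ` {x \<in> U. inv\<^bsub>G\<^esub> x \<in> W}) (\<lambda>z. \<eta> (inv\<^bsub>G\<^esub> (inv_into U \<phi> z)) i))"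

text \<open>
  Left-invariant vector fields, as derivations of the algebra of smooth functions (extended by
  \<open>0\<close> to non-smooth functions, so that equal vector fields are equal as HOL functions).
\<close>

definition left_invariant_field :: "'g group_manifold \<Rightarrow> (('g \<Rightarrow> real) \<Rightarrow> 'g \<Rightarrow> real) \<Rightarrow> bool" where
  "left_invariant_field G L \<longleftrightarrow>
     (\<forall>f. f \<notin> smooth_functions G \<longrightarrow> L f = (\<lambda>h. 0)) \<and>
     (\<forall>f\<in>smooth_functions G. L f \<in> smooth_functions G) \<and>
     (\<forall>f\<in>smooth_functions G. \<forall>f'\<in>smooth_functions G. \<forall>h.
        L (\<lambda>x. f x + f' x) h = L f h + L f' h \<and>
        L (\<lambda>x. f x * f' x) h = L f h * f' h + f h * L f' h) \<and>
     (\<forall>f\<in>smooth_functions G. \<forall>r h. L (\<lambda>x. r * f x) h = r * L f h) \<and>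
     (\<forall>f\<in>smooth_functions G. \<forall>g h. L (\<lambda>x. f (g \<otimes>\<^bsub>G\<^esub> x)) h = L f (g \<otimes>\<^bsub>G\<^esub> h))"

text \<open>
  A Harish-Chandra pair: \<open>lvf\<close> is the identification of the even part of the Lie superalgebra with
  the Lie algebra of left-invariant vector fields of the group, \<open>Ad\<close> the action of the group.
\<close>

record ('g, 'a) supergroup =
  grp :: "'g group_manifold"
  gpart :: "bit \<Rightarrow> 'a set"
  bracket :: "'a \<Rightarrow> 'a \<Rightarrow> 'a"
  lvf :: "'a \<Rightarrow> ('g \<Rightarrow> real) \<Rightarrow> 'g \<Rightarrow> real"
  Ad :: "'g \<Rightarrow> 'a \<Rightarrow> 'a"

definition lie_supergroup :: "('g, 'a::real_vector) supergroup \<Rightarrow> bool" where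
  "lie_supergroup G \<longleftrightarrow>
     lie_group (grp G) \<and>
     lie_superalgebra scaleR (gpart G) (bracket G) \<and>
     finite_dimensional (scaleR :: real \<Rightarrow> 'a \<Rightarrow> 'a) \<and>
     bij_betw (lvf G) (gpart G 0) {L. left_invariant_field (grp G) L} \<and>
     (\<forall>X\<in>gpart G 0. \<forall>Y\<in>gpart G 0. \<forall>f\<in>smooth_functions (grp G). \<forall>h.
        lvf G (X + Y) f h = lvf G X f h + lvf G Y f h \<and>
        lvf G (bracket G X Y) f h = lvf G X (lvf G Y f) h - lvf G Y (lvf G X f) h) \<and>
     (\<forall>X\<in>gpart G 0. \<forall>r. \<forall>f\<in>smooth_functions (grp G). \<forall>h. lvf G (r *\<^sub>R X) f h = r * lvf G X f h) \<and>
     (\<forall>X. Ad G \<one>\<^bsub>grp G\<^esub> X = X) \<and>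
     (\<forall>g h X. Ad G (g \<otimes>\<^bsub>grp G\<^esub> h) X = Ad G g (Ad G h X)) \<and>
     (\<forall>g. linear (Ad G g)) \<and>
     (\<forall>g a. \<forall>X\<in>gpart G a. Ad G g X \<in> gpart G a) \<and>
     (\<forall>g X Y. Ad G g (bracket G X Y) = bracket G (Ad G g X) (Ad G g Y)) \<and>
     (\<forall>l :: 'a \<Rightarrow> real. \<forall>Y. linear l \<longrightarrow>
        (\<lambda>g. l (Ad G g Y)) \<in> smooth_functions (grp G) \<and>
        (\<forall>X\<in>gpart G 0. lvf G X (\<lambda>g. l (Ad G g Y)) \<one>\<^bsub>grp G\<^esub> = l (bracket G X Y))) \<and>
     (\<forall>X\<in>gpart G 0. \<forall>f\<in>smooth_functions (grp G). \<forall>g h.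
        lvf G (Ad G g X) f h = lvf G X (\<lambda>x. f (x \<otimes>\<^bsub>grp G\<^esub> inv\<^bsub>grp G\<^esub> g)) (h \<otimes>\<^bsub>grp G\<^esub> g))"

text \<open>\<open>\<gamma>\<close> is the one-parameter subgroup \<open>t \<mapsto> exp (t X)\<close> of the even element \<open>X\<close>.\<close>

definition one_parameter_subgroup :: "('g, 'a) supergroup \<Rightarrow> 'a \<Rightarrow> (real \<Rightarrow> 'g) \<Rightarrow> bool" where
  "one_parameter_subgroup G X \<gamma> \<longleftrightarrow>
     (\<forall>s t. \<gamma> (s + t) = \<gamma> s \<otimes>\<^bsub>grp G\<^esub> \<gamma> t) \<and>
     (\<forall>f\<in>smooth_functions (grp G). \<forall>t.
        ((\<lambda>t. f (\<gamma> t)) has_real_derivative lvf G X f (\<gamma> t)) (at t))"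

text \<open>The condition on \<open>k \<inter> gpart G 0\<close> says that the even part of \<open>k\<close> is the Lie algebra of the closed subgroup \<open>K\<^sub>0\<close>.\<close>

definition closed_subsupergroup :: "('g, 'a::real_vector) supergroup \<Rightarrow> 'g set \<Rightarrow> 'a set \<Rightarrow> bool" where
  "closed_subsupergroup G K\<^sub>0 k \<longleftrightarrow>
     subgroup K\<^sub>0 (grp G) \<and> closedin (gtop (grp G)) K\<^sub>0 \<and>
     graded_subspace scaleR (gpart G) k \<and>
     k \<inter> gpart G 0 = {X \<in> gpart G 0. \<exists>\<gamma>. one_parameter_subgroup G X \<gamma> \<and> range \<gamma> \<subseteq> K\<^sub>0} \<and>
     (\<forall>X\<in>k. \<forall>Y\<in>k. bracket G X Y \<in> k) \<and>
     (\<forall>g\<in>K\<^sub>0. \<forall>X\<in>k. Ad G g X \<in> k)"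


section \<open>Supermanifolds\<close>

text \<open>
  A topological space with a sheaf of real superalgebras. The algebras of sections \<open>\<O>(U)\<close> are
  subsets of one ambient algebra (for instance the product of all of them), which supplies the
  operations; each has its own unit \<open>uni U\<close>. \<open>spart U a\<close> are the homogeneous sections of parity \<open>a\<close>,
  \<open>res U V\<close> is the restriction from \<open>U\<close> to \<open>V\<close> and \<open>body U f\<close> the real function on \<open>U\<close>
  underlying the section \<open>f\<close>.
\<close>

record ('p, 's) superspace =
  base :: "'p topology"
  spart :: "'p set \<Rightarrow> bit \<Rightarrow> 's set"
  uni :: "'p set \<Rightarrow> 's"
  res :: "'p set \<Rightarrow> 'p set \<Rightarrow> 's \<Rightarrow> 's"
  body :: "'p set \<Rightarrow> 's \<Rightarrow> 'p \<Rightarrow> real"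

definition sec :: "('p, 's::real_algebra) superspace \<Rightarrow> 'p set \<Rightarrow> 's set" where
  "sec M U = {f + f' | f f'. f \<in> spart M U 0 \<and> f' \<in> spart M U 1}"

definition linear_on :: "'s::real_vector set \<Rightarrow> ('s \<Rightarrow> 't::real_vector) \<Rightarrow> bool" where
  "linear_on S h \<longleftrightarrow> (\<forall>x\<in>S. \<forall>y\<in>S. h (x + y) = h x + h y) \<and> (\<forall>x\<in>S. \<forall>r. h (r *\<^sub>R x) = r *\<^sub>R h x)"

definition superalgebra_morphism ::
  "('p, 's::real_algebra) superspace \<Rightarrow> 'p set \<Rightarrow> 'p set \<Rightarrow> ('s \<Rightarrow> 's) \<Rightarrow> bool" where
  "superalgebra_morphism M U V h \<longleftrightarrow>
     linear_on (sec M U) h \<and> (\<forall>a. \<forall>f\<in>spart M U a. h f \<in> spart M V a) \<and>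
     (\<forall>f\<in>sec M U. \<forall>f'\<in>sec M U. h (f * f') = h f * h f') \<and> h (uni M U) = uni M V"

definition superalgebra_sheaf :: "('p, 's::real_algebra) superspace \<Rightarrow> bool" where
  "superalgebra_sheaf M \<longleftrightarrow>
     (\<forall>U. openin (base M) U \<longrightarrow>
        (\<forall>a. subspace (spart M U a)) \<and> spart M U 0 \<inter> spart M U 1 = {0} \<and>
        (\<forall>a b. \<forall>f\<in>spart M U a. \<forall>f'\<in>spart M U b.
           f * f' \<in> spart M U (a + b) \<and> f * f' = psign (a * b) *\<^sub>R (f' * f)) \<and>
        uni M U \<in> spart M U 0 \<and> (\<forall>f\<in>sec M U. uni M U * f = f \<and> f * uni M U = f) \<and>
        (\<forall>f\<in>sec M U. res M U U f = f)) \<and>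
     (\<forall>U V. openin (base M) U \<and> openin (base M) V \<and> V \<subseteq> U \<longrightarrow>
        superalgebra_morphism M U V (res M U V)) \<and>
     (\<forall>U V W. openin (base M) U \<and> openin (base M) V \<and> openin (base M) W \<and> W \<subseteq> V \<and> V \<subseteq> U \<longrightarrow>
        (\<forall>f\<in>sec M U. res M V W (res M U V f) = res M U W f)) \<and>
     (\<forall>\<U> s. (\<forall>V\<in>\<U>. openin (base M) V \<and> s V \<in> sec M V) \<and>
        (\<forall>V\<in>\<U>. \<forall>W\<in>\<U>. res M V (V \<inter> W) (s V) = res M W (V \<inter> W) (s W)) \<longrightarrow>
        (\<exists>!f. f \<in> sec M (\<Union>\<U>) \<and> (\<forall>V\<in>\<U>. res M (\<Union>\<U>) V f = s V)))"

text \<open>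
  The local model \<open>C\<^sup>\<infinity>(D) \<otimes> \<Lambda>(\<theta>\<^sub>0,\<dots>,\<theta>\<^bsub>q-1\<^esub>)\<close> over an open \<open>D \<subseteq> \<real>\<^sup>p\<close>: \<open>F I\<close> is the coefficient of
  \<open>\<theta>\<^sub>I\<close>, the product of the \<open>\<theta>\<^sub>i\<close>, \<open>i \<in> I\<close>, in increasing order.
\<close>

type_synonym superfunction = "nat set \<Rightarrow> (nat \<Rightarrow> real) \<Rightarrow> real"

definition model_sec :: "nat \<Rightarrow> nat \<Rightarrow> (nat \<Rightarrow> real) set \<Rightarrow> superfunction set" where
  "model_sec p q D =
     {F. (\<forall>I\<subseteq>{..<q}. smooth_on p D (F I)) \<and>
         (\<forall>I x. \<not> (I \<subseteq> {..<q} \<and> x \<in> D) \<longrightarrow> F I x = 0)}"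

definition model_mult :: "superfunction \<Rightarrow> superfunction \<Rightarrow> superfunction" where
  "model_mult F F' = (\<lambda>I x. \<Sum>J\<in>Pow I.
     (- 1) ^ card {(i, j). i \<in> J \<and> j \<in> I - J \<and> j < i} * F J x * F' (I - J) x)"

definition model_part :: "bit \<Rightarrow> superfunction set" where
  "model_part a = {F. \<forall>I. F I \<noteq> (\<lambda>x. 0) \<longrightarrow> of_nat (card I) = a}"

text \<open>
  A superchart on \<open>U\<close>: coordinates \<open>\<phi>\<close> of the underlying space, and an isomorphism \<open>\<Psi>\<close> of the
  sheaf of superalgebras over \<open>U\<close> with the local model. The last condition determines \<open>body\<close>.
\<close>

definition superchart ::
  "('p, 's::real_algebra) superspace \<Rightarrow> nat \<Rightarrow> nat \<Rightarrow> 'p set \<Rightarrow> ('p \<Rightarrow> nat \<Rightarrow> real)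
     \<Rightarrow> ('p set \<Rightarrow> 's \<Rightarrow> superfunction) \<Rightarrow> bool" where
  "superchart M p q U \<phi> \<Psi> \<longleftrightarrow>
     coordinate_chart (base M) p U \<phi> \<and>
     (\<forall>V. openin (base M) V \<and> V \<subseteq> U \<longrightarrow>
        bij_betw (\<Psi> V) (sec M V) (model_sec p q (\<phi> ` V)) \<and>
        (\<forall>f\<in>sec M V. \<forall>f'\<in>sec M V.
           \<Psi> V (f + f') = (\<lambda>I x. \<Psi> V f I x + \<Psi> V f' I x) \<and>
           \<Psi> V (f * f') = model_mult (\<Psi> V f) (\<Psi> V f')) \<and>
        (\<forall>f\<in>sec M V. \<forall>r. \<Psi> V (r *\<^sub>R f) = (\<lambda>I x. r * \<Psi> V f I x)) \<and>
        \<Psi> V (uni M V) = (\<lambda>I x. if I = {} \<and> x \<in> \<phi> ` V then 1 else 0) \<and>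
        (\<forall>f\<in>sec M V. \<forall>a. f \<in> spart M V a \<longleftrightarrow> \<Psi> V f \<in> model_part a) \<and>
        (\<forall>W f. openin (base M) W \<and> W \<subseteq> V \<and> f \<in> sec M V \<longrightarrow>
           \<Psi> W (res M V W f) = (\<lambda>I x. if x \<in> \<phi> ` W then \<Psi> V f I x else 0)))  \<and>
     (\<forall>V f x. openin (base M) V \<and> f \<in> sec M V \<and> x \<in> V \<inter> U \<longrightarrow>
        body M V f x = \<Psi> (V \<inter> U) (res M V (V \<inter> U) f) {} (\<phi> x))"

definition supermanifold :: "('p, 's::real_algebra) superspace \<Rightarrow> nat \<Rightarrow> nat \<Rightarrow> bool" where
  "supermanifold M p q \<longleftrightarrow>
     Hausdorff_space (base M) \<and> second_countable (base M) \<and> superalgebra_sheaf M \<and>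
     (\<forall>x\<in>topspace (base M). \<exists>U \<phi> \<Psi>. x \<in> U \<and> superchart M p q U \<phi> \<Psi>)"


section \<open>Vector fields and tangent vectors\<close>

text \<open>
  A vector field on \<open>U\<close> is a derivation of the sheaf restricted to \<open>U\<close>, i.e. a family of
  derivations of \<open>\<O>(V)\<close> for open \<open>V \<subseteq> U\<close>, compatible with restriction. Families are extended by
  \<open>0\<close> outside their domain, so that equality of vector fields is equality of HOL functions.
\<close>

type_synonym ('p, 's) vfield = "'p set \<Rightarrow> 's \<Rightarrow> 's"

definition vf :: "('p, 's::real_algebra) superspace \<Rightarrow> 'p set \<Rightarrow> bit \<Rightarrow> ('p, 's) vfield set" where
  "vf M U a = {X.
     (\<forall>V f. \<not> (openin (base M) V \<and> V \<subseteq> U \<and> f \<in> sec M V) \<longrightarrow> X V f = 0) \<and>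
     (\<forall>V. openin (base M) V \<and> V \<subseteq> U \<longrightarrow>
        linear_on (sec M V) (X V) \<and>
        (\<forall>b. \<forall>f\<in>spart M V b. X V f \<in> spart M V (a + b) \<and>
           (\<forall>f'\<in>sec M V. X V (f * f') = X V f * f' + psign (a * b) *\<^sub>R (f * X V f'))) \<and>
        (\<forall>W. openin (base M) W \<and> W \<subseteq> V \<longrightarrow>
           (\<forall>f\<in>sec M V. X W (res M V W f) = res M V W (X V f))))}"

definition vadd :: "('p, 's::real_algebra) vfield \<Rightarrow> ('p, 's) vfield \<Rightarrow> ('p, 's) vfield" where
  "vadd X Y = (\<lambda>V f. X V f + Y V f)"

definition vscale :: "real \<Rightarrow> ('p, 's::real_algebra) vfield \<Rightarrow> ('p, 's) vfield" where
  "vscale r X = (\<lambda>V f. r *\<^sub>R X V f)"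

definition vmult ::
  "('p, 's::real_algebra) superspace \<Rightarrow> 'p set \<Rightarrow> 's \<Rightarrow> ('p, 's) vfield \<Rightarrow> ('p, 's) vfield" where
  "vmult M U h X = (\<lambda>V f. res M U V h * X V f)"

definition vres :: "('p, 's::real_algebra) vfield \<Rightarrow> 'p set \<Rightarrow> ('p, 's) vfield" where
  "vres X W = (\<lambda>V f. if V \<subseteq> W then X V f else 0)"

text \<open>The supercommutator of vector fields \<open>X\<close>, \<open>Y\<close> of parities \<open>a\<close>, \<open>b\<close>.\<close>

definition vbracket ::
  "bit \<Rightarrow> bit \<Rightarrow> ('p, 's::real_algebra) vfield \<Rightarrow> ('p, 's) vfield \<Rightarrow> ('p, 's) vfield" where
  "vbracket a b X Y = (\<lambda>V f. X V (Y V f) - psign (a * b) *\<^sub>R Y V (X V f))"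

definition tangent_sheaf :: "('p, 's::real_algebra) superspace \<Rightarrow> 'p set \<Rightarrow> ('p, 's) vfield set" where
  "tangent_sheaf M U = {vadd X Y | X Y. X \<in> vf M U 0 \<and> Y \<in> vf M U 1}"

text \<open>
  Tangent vectors at \<open>x\<close> are derivations of the stalk at \<open>x\<close> with values in \<open>\<real>\<close>, given on
  the sections over the open neighbourhoods of \<open>x\<close>.
\<close>

type_synonym ('p, 's) tvector = "'p set \<Rightarrow> 's \<Rightarrow> real"

definition tvec :: "('p, 's::real_algebra) superspace \<Rightarrow> 'p \<Rightarrow> bit \<Rightarrow> ('p, 's) tvector set" where
  "tvec M x a = {v.
     (\<forall>V f. \<not> (openin (base M) V \<and> x \<in> V \<and> f \<in> sec M V) \<longrightarrow> v V f = 0) \<and>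
     (\<forall>V. openin (base M) V \<and> x \<in> V \<longrightarrow>
        linear_on (sec M V) (v V) \<and>
        (\<forall>b. \<forall>f\<in>spart M V b. (a + b \<noteq> 0 \<longrightarrow> v V f = 0) \<and>
           (\<forall>f'\<in>sec M V. v V (f * f') = v V f * body M V f' x + psign (a * b) * body M V f x * v V f')) \<and>
        (\<forall>W. openin (base M) W \<and> x \<in> W \<and> W \<subseteq> V \<longrightarrow> (\<forall>f\<in>sec M V. v W (res M V W f) = v V f)))}"

definition tangent_space :: "('p, 's::real_algebra) superspace \<Rightarrow> 'p \<Rightarrow> ('p, 's) tvector set" where
  "tangent_space M x = {\<lambda>V f. v V f + w V f | v w. v \<in> tvec M x 0 \<and> w \<in> tvec M x 1}"

text \<open>The value at \<open>x\<close> of a vector field on \<open>U\<close>.\<close>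

definition value_at ::
  "('p, 's::real_algebra) superspace \<Rightarrow> 'p set \<Rightarrow> ('p, 's) vfield \<Rightarrow> 'p \<Rightarrow> ('p, 's) tvector" where
  "value_at M U X x = (\<lambda>V f.
     if openin (base M) V \<and> x \<in> V \<and> f \<in> sec M V
     then body M (V \<inter> U) (X (V \<inter> U) (res M V (V \<inter> U) f)) x else 0)"


section \<open>Homogeneous superspaces\<close>

text \<open>
  The underlying space of \<open>G/K\<close> consists of the left cosets of \<open>K\<^sub>0\<close>; \<open>g\<close> acts on it by
  \<open>x \<mapsto> g <# x\<close>, and \<open>gpre G M g U\<close> is the preimage of \<open>U\<close> under this map.
\<close>

definition gpre ::
  "('g, 'a) supergroup \<Rightarrow> ('g set, 's) superspace \<Rightarrow> 'g \<Rightarrow> 'g set set \<Rightarrow> 'g set set" where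
  "gpre G M g U = {x \<in> topspace (base M). g <#\<^bsub>grp G\<^esub> x \<in> U}"

text \<open>
  The coefficient of \<open>\<theta>\<^sub>I\<close> at \<open>x\<close>, in the superchart \<open>(V, \<phi>, \<Psi>)\<close>, of the pullback along \<open>g\<close> of the
  section \<open>f\<close> over \<open>U\<close>.
\<close>

definition pull_coeff ::
  "('g, 'a) supergroup \<Rightarrow> ('g set, 's) superspace \<Rightarrow> ('g \<Rightarrow> 'g set set \<Rightarrow> 's \<Rightarrow> 's)
     \<Rightarrow> 'g set set \<Rightarrow> ('g set \<Rightarrow> nat \<Rightarrow> real) \<Rightarrow> ('g set set \<Rightarrow> 's \<Rightarrow> superfunction)
     \<Rightarrow> 'g set set \<Rightarrow> 's \<Rightarrow> nat set \<Rightarrow> 'g \<Rightarrow> 'g set \<Rightarrow> real" where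
  "pull_coeff G M pull V \<phi> \<Psi> U f I g x =
     \<Psi> (V \<inter> gpre G M g U) (res M (gpre G M g U) (V \<inter> gpre G M g U) (pull g U f)) I (\<phi> x)"

text \<open>
  Smooth action of the Lie group \<open>G\<^sub>0\<close> on a supermanifold of dimension \<open>p|q\<close> over \<open>G\<^sub>0/K\<^sub>0\<close>:
  \<open>pull g U\<close> is the pullback \<open>\<O>(U) \<rightarrow> \<O>(g\<^bsup>-1\<^esup>U)\<close> along \<open>g\<close>.
\<close>

definition group_action ::
  "('g, 'a) supergroup \<Rightarrow> ('g set, 's::real_algebra) superspace \<Rightarrow> nat \<Rightarrow> nat
     \<Rightarrow> ('g \<Rightarrow> 'g set set \<Rightarrow> 's \<Rightarrow> 's) \<Rightarrow> bool" where
  "group_action G M p q pull \<longleftrightarrow>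
     (\<forall>U. openin (base M) U \<longrightarrow>
        (\<forall>g. superalgebra_morphism M U (gpre G M g U) (pull g U)) \<and>
        (\<forall>f\<in>sec M U.
           pull \<one>\<^bsub>grp G\<^esub> U f = f \<and>
           (\<forall>g h. pull (g \<otimes>\<^bsub>grp G\<^esub> h) U f = pull h (gpre G M g U) (pull g U f)) \<and>
           (\<forall>g. \<forall>x\<in>gpre G M g U. body M (gpre G M g U) (pull g U f) x = body M U f (g <#\<^bsub>grp G\<^esub> x)) \<and>
           (\<forall>g V. openin (base M) V \<and> V \<subseteq> U \<longrightarrow>
              pull g V (res M U V f) = res M (gpre G M g U) (gpre G M g V) (pull g U f)) \<and>
           (\<forall>V \<phi> \<Psi>. superchart M p q V \<phi> \<Psi> \<longrightarrow>
              (\<forall>(W, \<eta>)\<in>atlas (grp G). \<forall>I\<subseteq>{..<q}.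
                 let n = gdim (grp G) in
                 smooth_on (n + p)
                   {z \<in> topspace (Euclidean_space (n + p)).
                      fst_block n z \<in> \<eta> ` W \<and> snd_block n z \<in> \<phi> ` V \<and>
                      inv_into W \<eta> (fst_block n z) <#\<^bsub>grp G\<^esub> inv_into V \<phi> (snd_block n z) \<in> U}
                   (\<lambda>z. pull_coeff G M pull V \<phi> \<Psi> U f I
                          (inv_into W \<eta> (fst_block n z)) (inv_into V \<phi> (snd_block n z)))))))"

text \<open>
  The infinitesimal action \<open>X \<mapsto> X\<^sup>\<dagger>\<close>, written \<open>dag\<close>: an anti-homomorphism from the Lie superalgebra
  to the vector fields, which on the even part is the derivative of the action of \<open>G\<^sub>0\<close>
  (computed coefficientwise in supercharts), and which is equivariant:
  \<open>(Ad\<^sub>g X)\<^sup>\<dagger> = (g\<^bsup>-1\<^esup>)\<^sup>* \<circ> X\<^sup>\<dagger> \<circ> g\<^sup>*\<close>.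
\<close>

definition infinitesimal_action ::
  "('g, 'a::real_vector) supergroup \<Rightarrow> ('g set, 's::real_algebra) superspace \<Rightarrow> nat \<Rightarrow> nat
     \<Rightarrow> ('g \<Rightarrow> 'g set set \<Rightarrow> 's \<Rightarrow> 's) \<Rightarrow> ('a \<Rightarrow> ('g set, 's) vfield) \<Rightarrow> bool" where
  "infinitesimal_action G M p q pull dag \<longleftrightarrow>
     (\<forall>a. \<forall>X\<in>gpart G a. dag X \<in> vf M (topspace (base M)) a) \<and>
     (\<forall>X Y. dag (X + Y) = vadd (dag X) (dag Y)) \<and>
     (\<forall>r X. dag (r *\<^sub>R X) = vscale r (dag X)) \<and>
     (\<forall>a b. \<forall>X\<in>gpart G a. \<forall>Y\<in>gpart G b.
        vbracket a b (dag X) (dag Y) = vscale (- 1) (dag (bracket G X Y))) \<and>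
     (\<forall>g X U. openin (base M) U \<longrightarrow> (\<forall>f\<in>sec M U.
        dag (Ad G g X) U f
          = pull (inv\<^bsub>grp G\<^esub> g) (gpre G M g U) (dag X (gpre G M g U) (pull g U f)))) \<and>
     (\<forall>X\<in>gpart G 0. \<forall>\<gamma>. one_parameter_subgroup G X \<gamma> \<longrightarrow>
        (\<forall>U V \<phi> \<Psi>. openin (base M) U \<and> superchart M p q V \<phi> \<Psi> \<longrightarrow>
          (\<forall>f\<in>sec M U. \<forall>I\<subseteq>{..<q}. \<forall>x\<in>V \<inter> U.
             ((\<lambda>t. pull_coeff G M pull V \<phi> \<Psi> U f I (\<gamma> t) x) has_real_derivative
                \<Psi> (V \<inter> U) (res M U (V \<inter> U) (dag X U f)) I (\<phi> x)) (at 0))))"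

text \<open>
  \<open>G/K\<close> is the (unique) supermanifold over \<open>G\<^sub>0/K\<^sub>0\<close> with an action of \<open>G = (G\<^sub>0, \<gg>)\<close> lifting the
  translations, which is transitive (\<open>\<gg>\<close> maps onto the tangent space at the base point) with
  stabiliser \<open>K = (K\<^sub>0, \<kk>)\<close> of the base point. The base point is \<open>K\<^sub>0\<close>, as a coset.
\<close>

definition homogeneous_superspace ::
  "('g, 'a::real_vector) supergroup \<Rightarrow> 'g set \<Rightarrow> 'a set \<Rightarrow> ('g set, 's::real_algebra) superspace
     \<Rightarrow> ('g \<Rightarrow> 'g set set \<Rightarrow> 's \<Rightarrow> 's) \<Rightarrow> ('a \<Rightarrow> ('g set, 's) vfield) \<Rightarrow> bool" where
  "homogeneous_superspace G K\<^sub>0 k M pull dag \<longleftrightarrow>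
     quotient_map (gtop (grp G)) (base M) (\<lambda>g. g <#\<^bsub>grp G\<^esub> K\<^sub>0) \<and>
     (\<exists>p q. supermanifold M p q \<and> group_action G M p q pull \<and>
            infinitesimal_action G M p q pull dag) \<and>
     range (\<lambda>X. value_at M (topspace (base M)) (dag X) K\<^sub>0) = tangent_space M K\<^sub>0 \<and>
     {X. value_at M (topspace (base M)) (dag X) K\<^sub>0 = (\<lambda>V f. 0)} = k"


section \<open>Graded Riemannian metrics and the Levi-Civita connection\<close>

type_synonym ('p, 's) metric = "'p set \<Rightarrow> ('p, 's) vfield \<Rightarrow> ('p, 's) vfield \<Rightarrow> 's"

text \<open>
  \<open>B\<close> is the scalar bilinear form induced on the tangent space at \<open>x\<close> by the \<open>\<O>\<close>-bilinear form \<open>g\<close>.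
\<close>

definition induced_form ::
  "('p, 's::real_algebra) superspace \<Rightarrow> ('p, 's) metric \<Rightarrow> 'p
     \<Rightarrow> (('p, 's) tvector \<Rightarrow> ('p, 's) tvector \<Rightarrow> real) \<Rightarrow> bool" where
  "induced_form M g x B \<longleftrightarrow>
     (\<forall>u\<in>tangent_space M x. \<forall>v\<in>tangent_space M x. \<forall>w\<in>tangent_space M x. \<forall>r.
        B (\<lambda>V f. u V f + v V f) w = B u w + B v w \<and> B (\<lambda>V f. r * v V f) w = r * B v w \<and>
        B w (\<lambda>V f. u V f + v V f) = B w u + B w v \<and> B w (\<lambda>V f. r * v V f) = r * B w v) \<and>
     (\<forall>U. openin (base M) U \<and> x \<in> U \<longrightarrow>
        (\<forall>X\<in>tangent_sheaf M U. \<forall>Y\<in>tangent_sheaf M U.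
           body M U (g U X Y) x = B (value_at M U X x) (value_at M U Y x)))"

text \<open>
  Non-degeneracy is that of the induced forms on all tangent spaces; for an \<open>\<O>\<close>-bilinear form this
  says that \<open>X \<mapsto> g(X, \<cdot>)\<close> is an isomorphism of the tangent sheaf onto its dual.
\<close>

definition graded_riemannian_metric ::
  "('p, 's::real_algebra) superspace \<Rightarrow> ('p, 's) metric \<Rightarrow> bool" where
  "graded_riemannian_metric M g \<longleftrightarrow>
     (\<forall>U. openin (base M) U \<longrightarrow>
        (\<forall>X\<in>tangent_sheaf M U. \<forall>Y\<in>tangent_sheaf M U. \<forall>Z\<in>tangent_sheaf M U.
           g U (vadd X Y) Z = g U X Z + g U Y Z \<and> g U X (vadd Y Z) = g U X Y + g U X Z) \<and>
        (\<forall>h\<in>sec M U. \<forall>X\<in>tangent_sheaf M U. \<forall>Y\<in>tangent_sheaf M U.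
           g U (vmult M U h X) Y = h * g U X Y) \<and>
        (\<forall>a b. \<forall>X\<in>vf M U a. \<forall>h\<in>spart M U b. \<forall>Y\<in>tangent_sheaf M U.
           g U X (vmult M U h Y) = psign (a * b) *\<^sub>R (h * g U X Y)) \<and>
        (\<forall>a b. \<forall>X\<in>vf M U a. \<forall>Y\<in>vf M U b.
           g U X Y \<in> spart M U (a + b) \<and> g U X Y = psign (a * b) *\<^sub>R g U Y X) \<and>
        (\<forall>V. openin (base M) V \<and> V \<subseteq> U \<longrightarrow>
           (\<forall>X\<in>tangent_sheaf M U. \<forall>Y\<in>tangent_sheaf M U.
              g V (vres X V) (vres Y V) = res M U V (g U X Y)))) \<and>
     (\<forall>x\<in>topspace (base M). \<exists>B. induced_form M g x B \<and>
        (\<forall>v\<in>tangent_space M x. (\<forall>w\<in>tangent_space M x. B v w = 0) \<longrightarrow> v = (\<lambda>V f. 0)))"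

text \<open>For a vector field \<open>Y\<close> on \<open>U\<close>, the vector field \<open>g\<^sup>* \<circ> Y \<circ> (g\<^bsup>-1\<^esup>)\<^sup>*\<close> on \<open>g\<^bsup>-1\<^esup>U\<close>.\<close>

definition vpull ::
  "('g, 'a) supergroup \<Rightarrow> ('g set, 's::real_algebra) superspace \<Rightarrow> ('g \<Rightarrow> 'g set set \<Rightarrow> 's \<Rightarrow> 's)
     \<Rightarrow> 'g \<Rightarrow> 'g set set \<Rightarrow> ('g set, 's) vfield \<Rightarrow> ('g set, 's) vfield" where
  "vpull G M pull g U Y = (\<lambda>V f.
     if openin (base M) V \<and> V \<subseteq> gpre G M g U \<and> f \<in> sec M V
     then let V' = gpre G M (inv\<^bsub>grp G\<^esub> g) V in pull g V' (Y V' (pull (inv\<^bsub>grp G\<^esub> g) V f))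
     else 0)"

definition invariant_metric ::
  "('g, 'a) supergroup \<Rightarrow> ('g set, 's::real_algebra) superspace \<Rightarrow> ('g \<Rightarrow> 'g set set \<Rightarrow> 's \<Rightarrow> 's)
     \<Rightarrow> ('a \<Rightarrow> ('g set, 's) vfield) \<Rightarrow> ('g set, 's) metric \<Rightarrow> bool" where
  "invariant_metric G M pull dag g \<longleftrightarrow>
     (\<forall>h U. openin (base M) U \<longrightarrow>
        (\<forall>Y\<in>tangent_sheaf M U. \<forall>Z\<in>tangent_sheaf M U.
           pull h U (g U Y Z)
             = g (gpre G M h U) (vpull G M pull h U Y) (vpull G M pull h U Z))) \<and>
     (\<forall>U a b c. openin (base M) U \<longrightarrow>
        (\<forall>X\<in>gpart G a. \<forall>Y\<in>vf M U b. \<forall>Z\<in>vf M U c.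
           dag X U (g U Y Z)
             = g U (vbracket a b (vres (dag X) U) Y) Z
               + psign (a * b) *\<^sub>R g U Y (vbracket a c (vres (dag X) U) Z)))"

type_synonym ('p, 's) conn = "'p set \<Rightarrow> ('p, 's) vfield \<Rightarrow> ('p, 's) vfield \<Rightarrow> ('p, 's) vfield"

definition connection :: "('p, 's::real_algebra) superspace \<Rightarrow> ('p, 's) conn \<Rightarrow> bool" where
  "connection M nab \<longleftrightarrow>
     (\<forall>U. openin (base M) U \<longrightarrow>
        (\<forall>a b. \<forall>X\<in>vf M U a. \<forall>Y\<in>vf M U b. nab U X Y \<in> vf M U (a + b)) \<and>
        (\<forall>X\<in>tangent_sheaf M U. \<forall>Y\<in>tangent_sheaf M U. \<forall>Z\<in>tangent_sheaf M U.
           nab U (vadd X Y) Z = vadd (nab U X Z) (nab U Y Z) \<and>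
           nab U X (vadd Y Z) = vadd (nab U X Y) (nab U X Z)) \<and>
        (\<forall>h\<in>sec M U. \<forall>X\<in>tangent_sheaf M U. \<forall>Y\<in>tangent_sheaf M U.
           nab U (vmult M U h X) Y = vmult M U h (nab U X Y)) \<and>
        (\<forall>a b. \<forall>X\<in>vf M U a. \<forall>h\<in>spart M U b. \<forall>Y\<in>tangent_sheaf M U.
           nab U X (vmult M U h Y)
             = vadd (vmult M U (X U h) Y) (vscale (psign (a * b)) (vmult M U h (nab U X Y)))) \<and>
        (\<forall>V. openin (base M) V \<and> V \<subseteq> U \<longrightarrow>
           (\<forall>X\<in>tangent_sheaf M U. \<forall>Y\<in>tangent_sheaf M U.
              nab V (vres X V) (vres Y V) = vres (nab U X Y) V)))"

definition levi_civita ::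
  "('p, 's::real_algebra) superspace \<Rightarrow> ('p, 's) metric \<Rightarrow> ('p, 's) conn \<Rightarrow> bool" where
  "levi_civita M g nab \<longleftrightarrow>
     connection M nab \<and>
     (\<forall>U a b. openin (base M) U \<longrightarrow> (\<forall>X\<in>vf M U a. \<forall>Y\<in>vf M U b.
        (\<forall>Z\<in>tangent_sheaf M U.
           X U (g U Y Z) = g U (nab U X Y) Z + psign (a * b) *\<^sub>R g U Y (nab U X Z)) \<and>
        vbracket a b X Y = vadd (nab U X Y) (vscale (- psign (a * b)) (nab U Y X))))"

text \<open>
  The Riemann curvature \<open>R(X, Y)Z\<close> for vector fields \<open>X\<close>, \<open>Y\<close> of parities \<open>a\<close>, \<open>b\<close>. On tangent
  vectors at a point it is evaluated by extending them to vector fields on a neighbourhood; the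
  result does not depend on the extensions.
\<close>

definition curvature ::
  "('p, 's::real_algebra) conn \<Rightarrow> 'p set \<Rightarrow> bit \<Rightarrow> bit
     \<Rightarrow> ('p, 's) vfield \<Rightarrow> ('p, 's) vfield \<Rightarrow> ('p, 's) vfield \<Rightarrow> ('p, 's) vfield" where
  "curvature nab U a b X Y Z =
     vadd (nab U (vbracket a b X Y) Z)
       (vadd (vscale (- 1) (nab U X (nab U Y Z)))
             (vscale (psign (a * b)) (nab U Y (nab U X Z))))"


section \<open>Data on the complement\<close>

definition orthogonal_complement ::
  "('a::real_vector \<times> 'a \<Rightarrow> 'a \<times> 'a \<Rightarrow> complex) \<Rightarrow> 'a set \<Rightarrow> 'a set \<Rightarrow> bool" where
  "orthogonal_complement Q k m \<longleftrightarrow>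
     m = {X. \<forall>Y\<in>k. Q (X, 0) (Y, 0) = 0} \<and>
     k \<inter> m = {0} \<and> (\<forall>X. \<exists>Y\<in>k. \<exists>Z\<in>m. X = Y + Z)"

text \<open>The component in \<open>m\<close> with respect to the decomposition \<open>\<gg> = k \<oplus> m\<close>.\<close>

definition mpart :: "'a::real_vector set \<Rightarrow> 'a set \<Rightarrow> 'a \<Rightarrow> 'a" where
  "mpart k m X = (THE Z. Z \<in> m \<and> X - Z \<in> k)"

text \<open>\<open>\<langle>X, Y\<rangle> = g\<^sub>K(X\<^sup>\<dagger>\<^sub>K, Y\<^sup>\<dagger>\<^sub>K)\<close>, where \<open>bp\<close> is the base point \<open>K\<close>.\<close>

definition scalar_superproduct ::
  "('p, 's::real_algebra) superspace \<Rightarrow> ('p, 's) metric \<Rightarrow> ('a \<Rightarrow> ('p, 's) vfield) \<Rightarrow> 'p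
     \<Rightarrow> 'a \<Rightarrow> 'a \<Rightarrow> real" where
  "scalar_superproduct M g dag bp X Y =
     body M (topspace (base M)) (g (topspace (base M)) (dag X) (dag Y)) bp"

definition U_map ::
  "('g, 'a::real_vector) supergroup \<Rightarrow> 'a set \<Rightarrow> 'a set \<Rightarrow> ('a \<Rightarrow> 'a \<Rightarrow> real) \<Rightarrow> ('a \<Rightarrow> 'a \<Rightarrow> 'a) \<Rightarrow> bool" where
  "U_map G k m ip U \<longleftrightarrow>
     (\<forall>X\<in>m. linear_on m (U X) \<and> linear_on m (\<lambda>Y. U Y X)) \<and>
     (\<forall>X\<in>m. \<forall>Y\<in>m. U X Y \<in> m) \<and>
     (\<forall>a b. \<forall>X\<in>m \<inter> gpart G a. \<forall>Y\<in>m \<inter> gpart G b. U X Y \<in> gpart G (a + b) \<and>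
        (\<forall>Z\<in>m. ip (U X Y) Z = - ip X (mpart k m (bracket G Y Z))
                   - psign (a * b) * ip Y (mpart k m (bracket G X Z))))"

end

theory Submission
  imports Defs
begin

text \<open>
  Tensoriality of the curvature is deduced from its symmetries: \<open>g(R(X, Y)Z, T)\<close> at a point depends
  on \<open>T\<close> only through its value there, and skew symmetry and pair symmetry transport this to the
  other arguments. Hence the given extensions may be replaced by the fundamental vector fields
  \<open>X\<^sup>\<dagger>\<close>, whose covariant derivatives are computed by the Koszul formula. As \<open>X\<^sup>\<dagger>\<close> is Killing and \<open>\<kk>\<close>
  is the radical of \<open>g\<^sub>K\<close> pulled back to \<open>\<gg>\<close>, this expresses the curvature by brackets in \<open>\<gg>\<close> and by
  \<open>\<langle>\<nabla>X\<^sup>\<dagger>, \<nabla>Y\<^sup>\<dagger>\<rangle>\<close>; the value of \<open>2\<nabla>\<^bsub>X\<^sup>\<dagger>\<^esub>Y\<^sup>\<dagger>\<close> at \<open>K\<close> is \<open>U(X, Y) - [X, Y]\<^bsub>\<mm>\<^esub>\<close>. The Jacobi identity gives the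
  formula.
\<close>

section \<open>Supermanifolds and their tangent vectors\<close>

text \<open>Deriving tensoriality from linearity over functions would mean expanding a field that
  vanishes at a point in a local frame. \<open>induced_form\<close> takes the place of frames: it
  factors \<open>g\<close> at a point through the values there, which settles the last slot of the
  curvature. The next obstacle is that second covariant derivatives require a derivative of the
  Koszul formula. Identities are therefore stated for an arbitrary linear functional on sections
  over \<open>W\<close>. Evaluation at the base point gives the values; evaluation after applying a
  fundamental field gives the derivative, which the Killing equation turns into brackets again. The
  last obstacle is that the Jacobi identity holds in the whole algebra, while the formula projects
  to \<open>m\<close>. Since \<open>B\<close> vanishes as soon as one argument is in
  \<open>k\<close>, an outermost projection can be inserted or removed at will. The inner
  projections, and the factor 4, come from the product of two covariant derivatives, each of which
  is half of a difference of \<open>U\<close> and a projected bracket.\<close>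

declare add_bit_eq_xor [simp del]

text \<open>A case distinction in the shape of an induction rule: it replaces a parity by 0 or 1 in
  inserted facts as well, so that every sign in them evaluates.\<close>

lemma bit_induct [induct type: bit]: "P 0 \<Longrightarrow> P 1 \<Longrightarrow> P (a::bit)"
  by (cases a) auto

lemma bit_one_plus_one [simp]: "1 + 1 = (0::bit)"
  by (simp add: add_bit_eq_xor)

lemma psign_0 [simp]: "psign 0 = 1" and psign_1 [simp]: "psign 1 = - 1"
  by (simp_all add: psign_def)

lemma psign_unit: "psign u = (1::real) \<or> psign u = - 1" "- psign u = (1::real) \<or> - psign u = - 1"
  by (cases u; simp)+

lemma linear_on_add: "linear_on S h \<Longrightarrow> x \<in> S \<Longrightarrow> y \<in> S \<Longrightarrow> h (x + y) = h x + h y"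
  and linear_on_scale: "linear_on S h \<Longrightarrow> x \<in> S \<Longrightarrow> h (r *\<^sub>R x) = r *\<^sub>R h x"
  by (simp_all add: linear_on_def)

lemma linear_on_zero: "linear_on S h \<Longrightarrow> x \<in> S \<Longrightarrow> h 0 = 0"
  using linear_on_scale[of S h x 0] by simp

lemma linear_on_diff_scale:
  assumes h: "linear_on S h" and S: "subspace S" and x: "x \<in> S" and y: "y \<in> S"
  shows "h (x - r *\<^sub>R y) = h x - r *\<^sub>R h y"
  using linear_on_add[OF h x subspace_scale[OF S y, of "- r"]] linear_on_scale[OF h y, of "- r"] by simp

locale smfd =
  fixes M :: "('p, 's::real_algebra) superspace" and p q :: nat
  assumes mfd: "supermanifold M p q"
begin

section \<open>Sections of the structure sheaf and their bodies\<close>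

lemma sheaf: "superalgebra_sheaf M"
  using mfd by (simp add: supermanifold_def)

lemmas sheaf_algebras = sheaf[unfolded superalgebra_sheaf_def, THEN conjunct1, THEN spec, THEN mp]

lemma spart_subspace: "openin (base M) U \<Longrightarrow> subspace (spart M U a)"
  using sheaf_algebras[THEN conjunct1] by blast

lemma spart_sec: "openin (base M) U \<Longrightarrow> f \<in> spart M U a \<Longrightarrow> f \<in> sec M U"
  using spart_subspace[of U 0] spart_subspace[of U 1] unfolding sec_def
  by (cases a) (force dest: subspace_0)+

lemma sec_subspace: "openin (base M) U \<Longrightarrow> subspace (sec M U)"
  using subspace_sums[OF spart_subspace[of U 0] spart_subspace[of U 1]] by (simp add: sec_def)

lemma spart_mult: "openin (base M) U \<Longrightarrow> f \<in> spart M U a \<Longrightarrow> h \<in> spart M U b \<Longrightarrow> f * h \<in> spart M U (a + b)"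
  using sheaf_algebras[THEN conjunct2, THEN conjunct2, THEN conjunct1] by blast

lemma sec_mult:
  assumes U: "openin (base M) U" and "f \<in> sec M U" "h \<in> sec M U"
  shows "f * h \<in> sec M U"
proof -
  obtain f0 f1 h0 h1 where *: "f = f0 + f1" "h = h0 + h1" "f0 \<in> spart M U 0" "f1 \<in> spart M U 1"
    "h0 \<in> spart M U 0" "h1 \<in> spart M U 1"
    using assms unfolding sec_def by blast
  have "f0 * h0 + f0 * h1 + (f1 * h0 + f1 * h1) \<in> sec M U"
    using * by (intro subspace_add[OF sec_subspace[OF U]] spart_sec[OF U spart_mult[OF U]])
  then show ?thesis
    using * by (simp add: algebra_simps)
qed

lemma res_morphism:
  "openin (base M) U \<Longrightarrow> openin (base M) V \<Longrightarrow> V \<subseteq> U \<Longrightarrow> superalgebra_morphism M U V (res M U V)"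
  using sheaf[unfolded superalgebra_sheaf_def, THEN conjunct2, THEN conjunct1] by blast

lemma res_linear: "openin (base M) U \<Longrightarrow> openin (base M) V \<Longrightarrow> V \<subseteq> U \<Longrightarrow> linear_on (sec M U) (res M U V)"
  and res_spart: "openin (base M) U \<Longrightarrow> openin (base M) V \<Longrightarrow> V \<subseteq> U \<Longrightarrow> f \<in> spart M U a \<Longrightarrow> res M U V f \<in> spart M V a"
  and res_mult: "openin (base M) U \<Longrightarrow> openin (base M) V \<Longrightarrow> V \<subseteq> U \<Longrightarrow> f \<in> sec M U \<Longrightarrow> h \<in> sec M U
    \<Longrightarrow> res M U V (f * h) = res M U V f * res M U V h"
  using res_morphism[of U V] unfolding superalgebra_morphism_def by blast+

lemma res_res: "openin (base M) U \<Longrightarrow> openin (base M) V \<Longrightarrow> openin (base M) W \<Longrightarrow> W \<subseteq> V \<Longrightarrow> V \<subseteq> U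
    \<Longrightarrow> f \<in> sec M U \<Longrightarrow> res M V W (res M U V f) = res M U W f"
  using sheaf[unfolded superalgebra_sheaf_def, THEN conjunct2, THEN conjunct2, THEN conjunct1] by blast

lemma res_sec:
  assumes U: "openin (base M) U" and V: "openin (base M) V" and sub: "V \<subseteq> U" and f: "f \<in> sec M U"
  shows "res M U V f \<in> sec M V"
proof -
  obtain f0 f1 where *: "f = f0 + f1" "f0 \<in> spart M U 0" "f1 \<in> spart M U 1"
    using f unfolding sec_def by blast
  then have "res M U V f = res M U V f0 + res M U V f1"
    using linear_on_add[OF res_linear[OF U V sub]] spart_sec[OF U] by blast
  then show ?thesis
    using * res_spart[OF U V sub] unfolding sec_def by blast
qed

lemma chart_at:
  assumes "openin (base M) U" "x \<in> U"
  obtains C \<phi> \<Psi> where "x \<in> C" "superchart M p q C \<phi> \<Psi>" "openin (base M) C"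
proof -
  have "x \<in> topspace (base M)"
    using assms openin_subset by blast
  then obtain C \<phi> \<Psi> where "x \<in> C" "superchart M p q C \<phi> \<Psi>"
    using mfd unfolding supermanifold_def by blast
  moreover from this have "openin (base M) C"
    unfolding superchart_def coordinate_chart_def by blast
  ultimately show thesis
    using that by blast
qed

lemma chart_body:
  "superchart M p q C \<phi> \<Psi> \<Longrightarrow> openin (base M) V \<Longrightarrow> f \<in> sec M V \<Longrightarrow> x \<in> V \<inter> C
    \<Longrightarrow> body M V f x = \<Psi> (V \<inter> C) (res M V (V \<inter> C) f) {} (\<phi> x)"
  by (drule superchart_def[THEN iffD1, THEN conjunct2, THEN conjunct2]) blast

lemma chart_section:
  assumes "superchart M p q C \<phi> \<Psi>" "openin (base M) V" "V \<subseteq> C" "f \<in> sec M V"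
  shows "f' \<in> sec M V \<Longrightarrow> \<Psi> V (f + f') = (\<lambda>I x. \<Psi> V f I x + \<Psi> V f' I x)"
    and "f' \<in> sec M V \<Longrightarrow> \<Psi> V (f * f') = model_mult (\<Psi> V f) (\<Psi> V f')"
    and "\<Psi> V (r *\<^sub>R f) = (\<lambda>I x. r * \<Psi> V f I x)"
    and "f \<in> spart M V a \<Longrightarrow> \<Psi> V f \<in> model_part a"
    and "openin (base M) W \<Longrightarrow> W \<subseteq> V \<Longrightarrow> \<Psi> W (res M V W f) = (\<lambda>I x. if x \<in> \<phi> ` W then \<Psi> V f I x else 0)"
proof -
  note * = assms(1)[unfolded superchart_def, THEN conjunct2, THEN conjunct1, THEN spec, THEN mp,
      OF conjI[OF assms(2,3)]]
  show "f' \<in> sec M V \<Longrightarrow> \<Psi> V (f + f') = (\<lambda>I x. \<Psi> V f I x + \<Psi> V f' I x)"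
    and "f' \<in> sec M V \<Longrightarrow> \<Psi> V (f * f') = model_mult (\<Psi> V f) (\<Psi> V f')"
    using *[THEN conjunct2, THEN conjunct1] assms(4) by blast+
  show "\<Psi> V (r *\<^sub>R f) = (\<lambda>I x. r * \<Psi> V f I x)"
    using *[THEN conjunct2, THEN conjunct2, THEN conjunct1] assms(4) by blast
  note ** = *[THEN conjunct2, THEN conjunct2, THEN conjunct2, THEN conjunct2]
  show "f \<in> spart M V a \<Longrightarrow> \<Psi> V f \<in> model_part a"
    using **[THEN conjunct1] assms(4) by blast
  show "openin (base M) W \<Longrightarrow> W \<subseteq> V \<Longrightarrow> \<Psi> W (res M V W f) = (\<lambda>I x. if x \<in> \<phi> ` W then \<Psi> V f I x else 0)"
    using **[THEN conjunct2] assms(4) by blast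
qed

lemma body_linear:
  assumes U: "openin (base M) U" and x: "x \<in> U"
  shows "linear_on (sec M U) (\<lambda>f. body M U f x)"
proof -
  obtain C \<phi> \<Psi> where C: "x \<in> C" "superchart M p q C \<phi> \<Psi>" "openin (base M) C"
    using chart_at[OF U x] .
  have V: "openin (base M) (U \<inter> C)"
    using U C by blast
  note b = chart_body[OF C(2) U _ IntI[OF x C(1)]]
  note l = res_linear[OF U V Int_lower1]
  note s = subspace_add[OF sec_subspace[OF U]] subspace_scale[OF sec_subspace[OF U]]
  note r = res_sec[OF U V Int_lower1]
  show ?thesis
    unfolding linear_on_def
    by (auto simp: b s linear_on_add[OF l] linear_on_scale[OF l]
        chart_section(1)[OF C(2) V Int_lower2 r r] chart_section(3)[OF C(2) V Int_lower2 r])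
qed

text \<open>Taking bodies is multiplicative because the coefficient with index {} in
  \<open>model_mult\<close> is a sum over the single subset {} of {}, with sign 1.\<close>

lemma body_mult:
  assumes U: "openin (base M) U" and x: "x \<in> U" and f: "f \<in> sec M U" and h: "h \<in> sec M U"
  shows "body M U (f * h) x = body M U f x * body M U h x"
proof -
  obtain C \<phi> \<Psi> where C: "x \<in> C" "superchart M p q C \<phi> \<Psi>" "openin (base M) C"
    using chart_at[OF U x] .
  have V: "openin (base M) (U \<inter> C)"
    using U C by blast
  note b = chart_body[OF C(2) U _ IntI[OF x C(1)]]
  note r = res_sec[OF U V Int_lower1]
  show ?thesis
    by (simp add: b f h sec_mult[OF U f h] res_mult[OF U V Int_lower1 f h]
        chart_section(2)[OF C(2) V Int_lower2 r r] model_mult_def)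
qed

text \<open>The body is the coefficient with index {}, and {} has an even number of
  elements.\<close>

lemma body_odd:
  assumes U: "openin (base M) U" and x: "x \<in> U" and f: "f \<in> spart M U 1"
  shows "body M U f x = 0"
proof -
  obtain C \<phi> \<Psi> where C: "x \<in> C" "superchart M p q C \<phi> \<Psi>" "openin (base M) C"
    using chart_at[OF U x] .
  have V: "openin (base M) (U \<inter> C)"
    using U C by blast
  note r = res_spart[OF U V Int_lower1 f]
  have "\<Psi> (U \<inter> C) (res M U (U \<inter> C) f) \<in> model_part 1"
    by (rule chart_section(4)[OF C(2) V Int_lower2 spart_sec[OF V r] r])
  then have "\<Psi> (U \<inter> C) (res M U (U \<inter> C) f) {} = (\<lambda>x. 0)"
    unfolding model_part_def by (metis (mono_tags, lifting) card.empty mem_Collect_eq of_nat_0 zero_neq_one)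
  then show ?thesis
    by (simp add: chart_body[OF C(2) U spart_sec[OF U f] IntI[OF x C(1)]])
qed

lemma body_res:
  assumes U: "openin (base M) U" and V: "openin (base M) V" and sub: "V \<subseteq> U" and x: "x \<in> V"
    and f: "f \<in> sec M U"
  shows "body M V (res M U V f) x = body M U f x"
proof -
  have xU: "x \<in> U"
    using sub x by blast
  obtain C \<phi> \<Psi> where C: "x \<in> C" "superchart M p q C \<phi> \<Psi>" "openin (base M) C"
    using chart_at[OF V x] .
  have UC: "openin (base M) (U \<inter> C)" and VC: "openin (base M) (V \<inter> C)" and s: "V \<inter> C \<subseteq> U \<inter> C"
    using U V C sub by blast+
  have "res M V (V \<inter> C) (res M U V f) = res M (U \<inter> C) (V \<inter> C) (res M U (U \<inter> C) f)"
    using res_res[OF U V VC _ sub f] res_res[OF U UC VC s _ f] by auto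
  then show ?thesis
    using x C(1) by (simp add: chart_body[OF C(2) V res_sec[OF U V sub f] IntI[OF x C(1)]]
        chart_body[OF C(2) U f IntI[OF xU C(1)]]
        chart_section(5)[OF C(2) UC Int_lower2 res_sec[OF U UC Int_lower1 f] VC s])
qed

section \<open>Vector fields, their restrictions and their values at a point\<close>

lemma vf_outside: "X \<in> vf M U a \<Longrightarrow> \<not> (openin (base M) V \<and> V \<subseteq> U \<and> f \<in> sec M V) \<Longrightarrow> X V f = 0"
  and vf_linear: "X \<in> vf M U a \<Longrightarrow> openin (base M) V \<Longrightarrow> V \<subseteq> U \<Longrightarrow> linear_on (sec M V) (X V)"
  and vf_spart: "X \<in> vf M U a \<Longrightarrow> openin (base M) V \<Longrightarrow> V \<subseteq> U \<Longrightarrow> f \<in> spart M V b \<Longrightarrow> X V f \<in> spart M V (a + b)"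
  and vf_leibniz: "X \<in> vf M U a \<Longrightarrow> openin (base M) V \<Longrightarrow> V \<subseteq> U \<Longrightarrow> f \<in> spart M V b \<Longrightarrow> h \<in> sec M V
    \<Longrightarrow> X V (f * h) = X V f * h + psign (a * b) *\<^sub>R (f * X V h)"
  and vf_res: "X \<in> vf M U a \<Longrightarrow> openin (base M) V \<Longrightarrow> V \<subseteq> U \<Longrightarrow> openin (base M) W \<Longrightarrow> W \<subseteq> V \<Longrightarrow> f \<in> sec M V
    \<Longrightarrow> X W (res M V W f) = res M V W (X V f)"
  unfolding vf_def mem_Collect_eq by (blast, meson+)

lemma vf_sec:
  assumes X: "X \<in> vf M U a" and V: "openin (base M) V" "V \<subseteq> U" and f: "f \<in> sec M V"
  shows "X V f \<in> sec M V"
proof -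
  obtain f0 f1 where *: "f = f0 + f1" "f0 \<in> spart M V 0" "f1 \<in> spart M V 1"
    using f unfolding sec_def by blast
  then have "X V f = X V f0 + X V f1"
    using linear_on_add[OF vf_linear[OF X V]] spart_sec[OF V(1)] by blast
  then show ?thesis
    using * subspace_add[OF sec_subspace[OF V(1)]] spart_sec[OF V(1) vf_spart[OF X V]] by metis
qed

lemma vf_zero:
  assumes X: "X \<in> vf M U a"
  shows "X V 0 = 0"
proof (cases "openin (base M) V \<and> V \<subseteq> U")
  case True
  then show ?thesis
    using linear_on_zero[OF vf_linear[OF X]] subspace_0[OF sec_subspace] by blast
qed (use vf_outside[OF X] in blast)

lemma vf_vadd:
  assumes X: "X \<in> vf M U a" and Y: "Y \<in> vf M U a"
  shows "vadd X Y \<in> vf M U a"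
  unfolding vf_def mem_Collect_eq vadd_def
proof (intro conjI allI impI ballI; (elim conjE)?)
  show "X V f + Y V f = 0" if "\<not> (openin (base M) V \<and> V \<subseteq> U \<and> f \<in> sec M V)" for V f
    using vf_outside[OF X that] vf_outside[OF Y that] by simp
  show "linear_on (sec M V) (\<lambda>f. X V f + Y V f)" if "openin (base M) V" "V \<subseteq> U" for V
    using vf_linear[OF X that] vf_linear[OF Y that] by (simp add: linear_on_def algebra_simps)
  show "X V f + Y V f \<in> spart M V (a + b)"
    if "openin (base M) V" "V \<subseteq> U" "f \<in> spart M V b" for V b f
    using vf_spart[OF X that] vf_spart[OF Y that] subspace_add[OF spart_subspace] that by blast
  show "X V (f * h) + Y V (f * h) = (X V f + Y V f) * h + psign (a * b) *\<^sub>R (f * (X V h + Y V h))"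
    if "openin (base M) V" "V \<subseteq> U" "f \<in> spart M V b" "h \<in> sec M V" for V b f h
    using vf_leibniz[OF X that] vf_leibniz[OF Y that] by (simp add: algebra_simps)
  show "X W (res M V W f) + Y W (res M V W f) = res M V W (X V f + Y V f)"
    if "openin (base M) V" "V \<subseteq> U" "openin (base M) W" "W \<subseteq> V" "f \<in> sec M V" for V W f
    using vf_res[OF X that] vf_res[OF Y that] that
      linear_on_add[OF res_linear[OF that(1,3,4)] vf_sec[OF X that(1,2,5)] vf_sec[OF Y that(1,2,5)]]
    by simp
qed

lemma vf_vscale:
  assumes X: "X \<in> vf M U a"
  shows "vscale r X \<in> vf M U a"
  unfolding vf_def mem_Collect_eq vscale_def
proof (intro conjI allI impI ballI; (elim conjE)?)
  show "r *\<^sub>R X V f = 0" if "\<not> (openin (base M) V \<and> V \<subseteq> U \<and> f \<in> sec M V)" for V f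
    using vf_outside[OF X that] by simp
  show "linear_on (sec M V) (\<lambda>f. r *\<^sub>R X V f)" if "openin (base M) V" "V \<subseteq> U" for V
    using vf_linear[OF X that] by (simp add: linear_on_def algebra_simps)
  show "r *\<^sub>R X V f \<in> spart M V (a + b)"
    if "openin (base M) V" "V \<subseteq> U" "f \<in> spart M V b" for V b f
    using vf_spart[OF X that] subspace_scale[OF spart_subspace] that by blast
  show "r *\<^sub>R X V (f * h) = r *\<^sub>R X V f * h + psign (a * b) *\<^sub>R (f * (r *\<^sub>R X V h))"
    if "openin (base M) V" "V \<subseteq> U" "f \<in> spart M V b" "h \<in> sec M V" for V b f h
    using vf_leibniz[OF X that] by (simp add: algebra_simps)
  show "r *\<^sub>R X W (res M V W f) = res M V W (r *\<^sub>R X V f)"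
    if "openin (base M) V" "V \<subseteq> U" "openin (base M) W" "W \<subseteq> V" "f \<in> sec M V" for V W f
    using vf_res[OF X that] linear_on_scale[OF res_linear[OF that(1,3,4)] vf_sec[OF X that(1,2,5)]]
    by simp
qed

lemma zero_vf: "openin (base M) U \<Longrightarrow> (\<lambda>V f. 0) \<in> vf M U a"
  unfolding vf_def
  by (auto simp: linear_on_def subspace_0[OF spart_subspace]
      linear_on_zero[OF res_linear subspace_0[OF sec_subspace]])

lemma vf_tangent_sheaf:
  assumes U: "openin (base M) U" and X: "X \<in> vf M U a"
  shows "X \<in> tangent_sheaf M U"
proof -
  have "X = vadd X (\<lambda>V f. 0)" "X = vadd (\<lambda>V f. 0) X"
    by (simp_all add: vadd_def)
  then show ?thesis
    using X zero_vf[OF U] unfolding tangent_sheaf_def by (cases a) blast+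
qed

lemma vf_vres:
  assumes X: "X \<in> vf M U a" and W: "openin (base M) W" "W \<subseteq> U"
  shows "vres X W \<in> vf M W a"
  unfolding vf_def mem_Collect_eq vres_def
proof (intro conjI allI impI ballI; (elim conjE)?)
  show "(if V \<subseteq> W then X V f else 0) = 0" if "\<not> (openin (base M) V \<and> V \<subseteq> W \<and> f \<in> sec M V)" for V f
    using vf_outside[OF X, of V f] that by auto
  show "linear_on (sec M V) (\<lambda>f. if V \<subseteq> W then X V f else 0)" if "openin (base M) V" "V \<subseteq> W" for V
    using vf_linear[OF X, of V] that W by simp
  show "(if V \<subseteq> W then X V f else 0) \<in> spart M V (a + b)"
    if "openin (base M) V" "V \<subseteq> W" "f \<in> spart M V b" for V b f
    using vf_spart[OF X, of V f b] that W by simp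
  show "(if V \<subseteq> W then X V (f * h) else 0) = (if V \<subseteq> W then X V f else 0) * h
      + psign (a * b) *\<^sub>R (f * (if V \<subseteq> W then X V h else 0))"
    if "openin (base M) V" "V \<subseteq> W" "f \<in> spart M V b" "h \<in> sec M V" for V b f h
    using vf_leibniz[OF X, of V f b h] that W by simp
  show "(if V' \<subseteq> W then X V' (res M V V' f) else 0) = res M V V' (if V \<subseteq> W then X V f else 0)"
    if "openin (base M) V" "V \<subseteq> W" "openin (base M) V'" "V' \<subseteq> V" "f \<in> sec M V" for V V' f
    using vf_res[OF X, of V V' f] that W by auto
qed

lemma value_at_vf:
  assumes U: "openin (base M) U" and x: "x \<in> U" and X: "X \<in> vf M U a"
  shows "value_at M U X x \<in> tvec M x a"
  unfolding tvec_def mem_Collect_eq value_at_def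
proof (intro conjI allI impI ballI; (elim conjE)?)
  fix V assume V: "openin (base M) V" "x \<in> V"
  have VU: "openin (base M) (V \<inter> U)" "V \<inter> U \<subseteq> V" "V \<inter> U \<subseteq> U" "x \<in> V \<inter> U"
    using U x V by auto
  note l = linear_on_add linear_on_scale
  note r = res_linear[OF V(1) VU(1,2)] res_sec[OF V(1) VU(1,2)]
  note b = body_linear[OF VU(1,4)]
  note Xl = vf_linear[OF X VU(1,3)] vf_sec[OF X VU(1,3)]
  have cond: "(openin (base M) V \<and> x \<in> V \<and> f \<in> sec M V) \<longleftrightarrow> f \<in> sec M V" for f
    using V by simp
  show "linear_on (sec M V) (\<lambda>f. if openin (base M) V \<and> x \<in> V \<and> f \<in> sec M V
      then body M (V \<inter> U) (X (V \<inter> U) (res M V (V \<inter> U) f)) x else 0)"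
    unfolding linear_on_def cond
    by (auto simp: subspace_add[OF sec_subspace[OF V(1)]] subspace_scale[OF sec_subspace[OF V(1)]]
        l[OF r(1)] r(2) l[OF Xl(1)] Xl(2) l[OF b])
  show "(if openin (base M) V \<and> x \<in> V \<and> f \<in> sec M V
      then body M (V \<inter> U) (X (V \<inter> U) (res M V (V \<inter> U) f)) x else 0) = 0"
    if f: "f \<in> spart M V c" and "a + c \<noteq> 0" for c f
  proof -
    have "a + c = 1"
      using that by simp
    then show ?thesis
      using body_odd[OF VU(1,4)] vf_spart[OF X VU(1,3) res_spart[OF V(1) VU(1,2) f]] by simp
  qed
  show "(if openin (base M) V \<and> x \<in> V \<and> f * h \<in> sec M V
      then body M (V \<inter> U) (X (V \<inter> U) (res M V (V \<inter> U) (f * h))) x else 0) =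
      (if openin (base M) V \<and> x \<in> V \<and> f \<in> sec M V
       then body M (V \<inter> U) (X (V \<inter> U) (res M V (V \<inter> U) f)) x else 0) * body M V h x
      + psign (a * c) * body M V f x * (if openin (base M) V \<and> x \<in> V \<and> h \<in> sec M V
       then body M (V \<inter> U) (X (V \<inter> U) (res M V (V \<inter> U) h)) x else 0)"
    if f: "f \<in> spart M V c" and h: "h \<in> sec M V" for c f h
  proof -
    have fs: "f \<in> sec M V"
      using spart_sec[OF V(1) f] .
    have rf: "res M V (V \<inter> U) f \<in> spart M (V \<inter> U) c"
      using res_spart[OF V(1) VU(1,2) f] .
    show ?thesis
      by (simp add: V fs h sec_mult res_mult[OF V(1) VU(1,2)] r vf_leibniz[OF X VU(1,3) rf] l[OF b] Xl
          sec_mult[OF VU(1)] subspace_scale[OF sec_subspace[OF VU(1)]] body_mult[OF VU(1,4)]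
          body_res[OF V(1) VU(1,2,4)])
  qed
  show "(if openin (base M) V' \<and> x \<in> V' \<and> res M V V' f \<in> sec M V'
      then body M (V' \<inter> U) (X (V' \<inter> U) (res M V' (V' \<inter> U) (res M V V' f))) x else 0) =
      (if openin (base M) V \<and> x \<in> V \<and> f \<in> sec M V
       then body M (V \<inter> U) (X (V \<inter> U) (res M V (V \<inter> U) f)) x else 0)"
    if V': "openin (base M) V'" "x \<in> V'" "V' \<subseteq> V" and f: "f \<in> sec M V" for V' f
  proof -
    have VU': "openin (base M) (V' \<inter> U)" "V' \<inter> U \<subseteq> V'" "V' \<inter> U \<subseteq> V \<inter> U" "x \<in> V' \<inter> U"
      using U x V' by auto
    have "res M V' (V' \<inter> U) (res M V V' f) = res M (V \<inter> U) (V' \<inter> U) (res M V (V \<inter> U) f)"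
      using res_res[OF V(1) V'(1) VU'(1,2) V'(3) f] res_res[OF V(1) VU(1) VU'(1,3) VU(2) f] by simp
    then show ?thesis
      by (simp add: V V' f res_sec[OF V(1) V'(1,3) f] vf_res[OF X VU(1,3) VU'(1,3) r(2)[OF f]]
          body_res[OF VU(1) VU'(1,3,4)] Xl r)
  qed
qed auto

lemma value_at_vadd:
  assumes U: "openin (base M) U" and x: "x \<in> U" and X: "X \<in> vf M U a" and Y: "Y \<in> vf M U b"
  shows "value_at M U (vadd X Y) x = (\<lambda>V f. value_at M U X x V f + value_at M U Y x V f)"
proof (intro ext)
  fix V f
  show "value_at M U (vadd X Y) x V f = value_at M U X x V f + value_at M U Y x V f"
  proof (cases "openin (base M) V \<and> x \<in> V \<and> f \<in> sec M V")
    case True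
    then have VU: "openin (base M) (V \<inter> U)" "V \<inter> U \<subseteq> V" "V \<inter> U \<subseteq> U" "x \<in> V \<inter> U"
      using U x by auto
    have r: "res M V (V \<inter> U) f \<in> sec M (V \<inter> U)"
      using res_sec[OF _ VU(1,2)] True by blast
    show ?thesis
      using True linear_on_add[OF body_linear[OF VU(1,4)] vf_sec[OF X VU(1,3) r] vf_sec[OF Y VU(1,3) r]]
      by (simp add: value_at_def vadd_def)
  qed (auto simp: value_at_def)
qed

lemma value_at_tangent_space:
  assumes U: "openin (base M) U" and x: "x \<in> U" and X: "X \<in> tangent_sheaf M U"
  shows "value_at M U X x \<in> tangent_space M x"
proof -
  obtain Y Z where *: "X = vadd Y Z" "Y \<in> vf M U 0" "Z \<in> vf M U 1"
    using X unfolding tangent_sheaf_def by blast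
  show ?thesis
    unfolding *(1) value_at_vadd[OF U x *(2,3)] tangent_space_def
    using value_at_vf[OF U x *(2)] value_at_vf[OF U x *(3)] by blast
qed

lemma tangent_sheaf_vadd:
  assumes X: "X \<in> tangent_sheaf M U" and Y: "Y \<in> tangent_sheaf M U"
  shows "vadd X Y \<in> tangent_sheaf M U"
proof -
  obtain X0 X1 Y0 Y1 where *: "X = vadd X0 X1" "X0 \<in> vf M U 0" "X1 \<in> vf M U 1"
    "Y = vadd Y0 Y1" "Y0 \<in> vf M U 0" "Y1 \<in> vf M U 1"
    using X Y unfolding tangent_sheaf_def by blast
  have "vadd X Y = vadd (vadd X0 Y0) (vadd X1 Y1)"
    using * by (simp add: vadd_def fun_eq_iff)
  then show ?thesis
    using * vf_vadd unfolding tangent_sheaf_def by blast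
qed

lemma tangent_sheaf_vscale:
  assumes X: "X \<in> tangent_sheaf M U"
  shows "vscale r X \<in> tangent_sheaf M U"
proof -
  obtain X0 X1 where *: "X = vadd X0 X1" "X0 \<in> vf M U 0" "X1 \<in> vf M U 1"
    using X unfolding tangent_sheaf_def by blast
  have "vscale r X = vadd (vscale r X0) (vscale r X1)"
    using * by (simp add: vadd_def vscale_def fun_eq_iff algebra_simps)
  then show ?thesis
    using * vf_vscale unfolding tangent_sheaf_def by blast
qed

lemma tangent_sheaf_vres:
  assumes X: "X \<in> tangent_sheaf M U" and W: "openin (base M) W" "W \<subseteq> U"
  shows "vres X W \<in> tangent_sheaf M W"
proof -
  obtain X0 X1 where *: "X = vadd X0 X1" "X0 \<in> vf M U 0" "X1 \<in> vf M U 1"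
    using X unfolding tangent_sheaf_def by blast
  have "vres X W = vadd (vres X0 W) (vres X1 W)"
    using * by (simp add: vadd_def vres_def fun_eq_iff)
  then show ?thesis
    using * vf_vres[OF _ W] unfolding tangent_sheaf_def by blast
qed

lemma value_at_vres_vf:
  assumes U: "openin (base M) U" and W: "openin (base M) W" "W \<subseteq> U" and x: "x \<in> W"
    and X: "X \<in> vf M U a"
  shows "value_at M W (vres X W) x = value_at M U X x"
proof (intro ext)
  fix V f
  show "value_at M W (vres X W) x V f = value_at M U X x V f"
  proof (cases "openin (base M) V \<and> x \<in> V \<and> f \<in> sec M V")
    case True
    then have V: "openin (base M) V" and f: "f \<in> sec M V"
      and VU: "openin (base M) (V \<inter> U)" "V \<inter> U \<subseteq> V" "V \<inter> U \<subseteq> U"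
      and VW: "openin (base M) (V \<inter> W)" "V \<inter> W \<subseteq> V \<inter> U" "x \<in> V \<inter> W"
      using U W x by auto
    have r: "res M V (V \<inter> U) f \<in> sec M (V \<inter> U)"
      using res_sec[OF V VU(1,2) f] .
    have "res M V (V \<inter> W) f = res M (V \<inter> U) (V \<inter> W) (res M V (V \<inter> U) f)"
      using res_res[OF V VU(1) VW(1,2) VU(2) f] by simp
    then show ?thesis
      using True by (simp add: value_at_def vres_def vf_res[OF X VU(1,3) VW(1,2) r]
          body_res[OF VU(1) VW] vf_sec[OF X VU(1,3) r])
  qed (auto simp: value_at_def)
qed

lemma value_at_vres:
  assumes U: "openin (base M) U" and W: "openin (base M) W" "W \<subseteq> U" and x: "x \<in> W"
    and X: "X \<in> tangent_sheaf M U"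
  shows "value_at M W (vres X W) x = value_at M U X x"
proof -
  obtain Y Z where *: "X = vadd Y Z" "Y \<in> vf M U 0" "Z \<in> vf M U 1"
    using X unfolding tangent_sheaf_def by blast
  have "vres X W = vadd (vres Y W) (vres Z W)"
    by (simp add: * vadd_def vres_def fun_eq_iff)
  moreover have "x \<in> U"
    using W x by blast
  ultimately show ?thesis
    using value_at_vadd[OF W(1) x vf_vres[OF *(2) W] vf_vres[OF *(3) W]] value_at_vadd[OF U _ *(2,3)]
      value_at_vres_vf[OF U W x *(2)] value_at_vres_vf[OF U W x *(3)] *(1) by simp
qed

end

section \<open>The curvature of a graded Riemannian metric\<close>

text \<open>The classical octahedron argument with signs: the four cyclic identities, one for each
  choice of the argument left in place, are combined so that all pairs except the two in the claim
  cancel.\<close>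

lemma curvature_pair_symmetry:
  fixes R :: "'v \<Rightarrow> 'v \<Rightarrow> 'v \<Rightarrow> 'v \<Rightarrow> real" and \<pi> :: "'v \<Rightarrow> bit"
  assumes skew12: "\<And>x y z t. x \<in> S \<Longrightarrow> y \<in> S \<Longrightarrow> z \<in> S \<Longrightarrow> t \<in> S
      \<Longrightarrow> R y x z t = - psign (\<pi> x * \<pi> y) * R x y z t"
    and skew34: "\<And>x y z t. x \<in> S \<Longrightarrow> y \<in> S \<Longrightarrow> z \<in> S \<Longrightarrow> t \<in> S
      \<Longrightarrow> R x y z t = - psign (\<pi> z * \<pi> t) * R x y t z"
    and bianchi: "\<And>x y z t. x \<in> S \<Longrightarrow> y \<in> S \<Longrightarrow> z \<in> S \<Longrightarrow> t \<in> S
      \<Longrightarrow> R x y z t + psign (\<pi> x * (\<pi> y + \<pi> z)) * R y z x t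
            + psign (\<pi> z * (\<pi> x + \<pi> y)) * R z x y t = 0"
    and S: "x \<in> S" "y \<in> S" "z \<in> S" "t \<in> S"
  shows "R x y z t = psign ((\<pi> x + \<pi> y) * (\<pi> z + \<pi> t)) * R z t x y"
proof -
  note bs = bianchi[OF S(1,2,3,4)] bianchi[OF S(2,3,4,1)] bianchi[OF S(3,4,1,2)] bianchi[OF S(4,1,2,3)]
  \<comment> \<open>Up to sign, the twelve terms of the four cyclic identities are only six
    quantities, each occurring twice; these instances of skew symmetry identify them. What remains
    is linear in each of the sixteen parity patterns.\<close>
  note s = skew34[OF S(2,3,1,4)] skew12[OF S(1,3,2,4)] skew12[OF S(1,3,4,2)] skew34[OF S(1,3,4,2)]
    skew12[OF S(2,4,3,1)] skew34[OF S(2,4,3,1)] skew34[OF S(3,4,1,2)] skew12[OF S(1,4,3,2)]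
    skew34[OF S(1,4,3,2)] skew34[OF S(1,2,4,3)] skew12[OF S(2,4,1,3)] skew12[OF S(1,4,2,3)]
    skew34[OF S(1,4,2,3)]
  obtain a b c d where \<pi>: "\<pi> x = a" "\<pi> y = b" "\<pi> z = c" "\<pi> t = d"
    by blast
  show ?thesis
    unfolding \<pi>
    by (insert bs[unfolded \<pi>] s[unfolded \<pi>], induct a; induct b; induct c; induct d)
      (simp_all (no_asm_use) only: psign_0 psign_1 mult_zero_left mult_zero_right mult_1 mult_1_right
        bit_one_plus_one add_0 add_0_right mult_minus_left minus_minus)
qed

locale levi_civita_smfd = smfd M p q
  for M :: "('p, 's::real_algebra) superspace" and p q +
  fixes g :: "('p, 's) metric" and nab :: "('p, 's) conn" and W :: "'p set" and o\<^sub>p :: 'p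
  assumes metric: "graded_riemannian_metric M g"
    and levi_civita: "levi_civita M g nab"
    and W: "openin (base M) W"
    and o_W: "o\<^sub>p \<in> W"
begin

section \<open>Algebra of the metric and of the connection over \<open>W\<close>\<close>

lemmas metric_on = metric[unfolded graded_riemannian_metric_def, THEN conjunct1, THEN spec, THEN mp, OF W]

lemma g_vadd:
  assumes "X \<in> tangent_sheaf M W" "Y \<in> tangent_sheaf M W" "Z \<in> tangent_sheaf M W"
  shows "g W (vadd X Y) Z = g W X Z + g W Y Z" "g W Z (vadd X Y) = g W Z X + g W Z Y"
  using metric_on[THEN conjunct1] assms by blast+

lemmas metric_on_homogeneous =
  metric_on[THEN conjunct2, THEN conjunct2, THEN conjunct2, THEN conjunct1]

lemma g_spart: "X \<in> vf M W a \<Longrightarrow> Y \<in> vf M W b \<Longrightarrow> g W X Y \<in> spart M W (a + b)"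
  and g_super_sym: "X \<in> vf M W a \<Longrightarrow> Y \<in> vf M W b \<Longrightarrow> g W X Y = psign (a * b) *\<^sub>R g W Y X"
  using metric_on_homogeneous by blast+

lemma g_sec:
  assumes X: "X \<in> tangent_sheaf M W" and Y: "Y \<in> tangent_sheaf M W"
  shows "g W X Y \<in> sec M W"
proof -
  obtain X0 X1 Y0 Y1 where *: "X = vadd X0 X1" "X0 \<in> vf M W 0" "X1 \<in> vf M W 1"
    "Y = vadd Y0 Y1" "Y0 \<in> vf M W 0" "Y1 \<in> vf M W 1"
    using X Y unfolding tangent_sheaf_def by blast
  note v = vf_tangent_sheaf[OF W]
  have "g W X Y = g W X0 Y0 + g W X0 Y1 + (g W X1 Y0 + g W X1 Y1)"
    using * v by (simp add: g_vadd tangent_sheaf_vadd)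
  moreover have "\<dots> \<in> sec M W"
    using * by (intro subspace_add[OF sec_subspace[OF W]] spart_sec[OF W g_spart])
  ultimately show ?thesis by simp
qed

lemma vadd_cancel: "vadd X (vscale (- 1) X) = (\<lambda>V f. 0)"
  and vadd_zero: "vadd X (\<lambda>V f. 0) = X"
  and vscale_one: "vscale 1 X = X"
  by (simp_all add: vadd_def vscale_def)

lemma zero_tangent_sheaf: "(\<lambda>V f. 0) \<in> tangent_sheaf M W"
  using vf_tangent_sheaf[OF W zero_vf[OF W]] .

text \<open>The only scalars that occur below are signs; for -1, additivity applied to X + (-X) = 0
  gives the claim.\<close>

lemma g_vscale:
  assumes r: "r = 1 \<or> r = - 1" and X: "X \<in> tangent_sheaf M W" and Z: "Z \<in> tangent_sheaf M W"
  shows "g W (vscale r X) Z = r *\<^sub>R g W X Z" "g W Z (vscale r X) = r *\<^sub>R g W Z X"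
proof -
  note z = zero_tangent_sheaf
  note m = tangent_sheaf_vscale[OF X, of "- 1"]
  have "g W (\<lambda>V f. 0) Z = 0" "g W Z (\<lambda>V f. 0) = 0"
    using g_vadd[OF z z Z] by (simp_all add: vadd_zero)
  moreover have "g W (vadd X (vscale (- 1) X)) Z = g W X Z + g W (vscale (- 1) X) Z"
    "g W Z (vadd X (vscale (- 1) X)) = g W Z X + g W Z (vscale (- 1) X)"
    using g_vadd[OF X m Z] by simp_all
  ultimately have "g W (vscale (- 1) X) Z = - g W X Z" "g W Z (vscale (- 1) X) = - g W Z X"
    unfolding vadd_cancel by (metis minus_unique)+
  then show "g W (vscale r X) Z = r *\<^sub>R g W X Z" "g W Z (vscale r X) = r *\<^sub>R g W Z X"
    using r by (auto simp: vscale_one)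
qed

lemmas connection_on =
  levi_civita[unfolded levi_civita_def, THEN conjunct1, unfolded connection_def, THEN spec, THEN mp, OF W]

lemma nab_vf: "X \<in> vf M W a \<Longrightarrow> Y \<in> vf M W b \<Longrightarrow> nab W X Y \<in> vf M W (a + b)"
  using connection_on[THEN conjunct1] by blast

lemma nab_vadd:
  assumes "X \<in> tangent_sheaf M W" "Y \<in> tangent_sheaf M W" "Z \<in> tangent_sheaf M W"
  shows "nab W (vadd X Y) Z = vadd (nab W X Z) (nab W Y Z)"
    "nab W Z (vadd X Y) = vadd (nab W Z X) (nab W Z Y)"
  using connection_on[THEN conjunct2, THEN conjunct1] assms by blast+

lemma nab_vscale:
  assumes r: "r = 1 \<or> r = - 1" and X: "X \<in> tangent_sheaf M W" and Z: "Z \<in> tangent_sheaf M W"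
  shows "nab W (vscale r X) Z = vscale r (nab W X Z)" "nab W Z (vscale r X) = vscale r (nab W Z X)"
proof -
  note z = zero_tangent_sheaf
  note m = tangent_sheaf_vscale[OF X, of "- 1"]
  have "nab W (\<lambda>V f. 0) Z = (\<lambda>V f. 0)" "nab W Z (\<lambda>V f. 0) = (\<lambda>V f. 0)"
    using nab_vadd[OF z z Z] by (simp_all add: vadd_zero, simp_all add: vadd_def fun_eq_iff)
  moreover have "nab W (vadd X (vscale (- 1) X)) Z = vadd (nab W X Z) (nab W (vscale (- 1) X) Z)"
    "nab W Z (vadd X (vscale (- 1) X)) = vadd (nab W Z X) (nab W Z (vscale (- 1) X))"
    using nab_vadd[OF X m Z] by simp_all
  ultimately have "nab W (vscale (- 1) X) Z = vscale (- 1) (nab W X Z)"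
    "nab W Z (vscale (- 1) X) = vscale (- 1) (nab W Z X)"
    unfolding vadd_cancel by (simp_all add: vadd_def vscale_def fun_eq_iff eq_neg_iff_add_eq_0 add.commute)
  then show "nab W (vscale r X) Z = vscale r (nab W X Z)" "nab W Z (vscale r X) = vscale r (nab W Z X)"
    using r by (auto simp: vscale_one)
qed

lemma metric_compatible:
  assumes "X \<in> vf M W a" "Y \<in> vf M W b" "Z \<in> vf M W c"
  shows "X W (g W Y Z) = g W (nab W X Y) Z + psign (a * b) *\<^sub>R g W Y (nab W X Z)"
  using levi_civita[unfolded levi_civita_def, THEN conjunct2, THEN spec, THEN spec, THEN spec, THEN mp, OF W]
    assms vf_tangent_sheaf[OF W assms(3)] by blast

lemma torsion_free:
  assumes "X \<in> vf M W a" "Y \<in> vf M W b"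
  shows "vbracket a b X Y = vadd (nab W X Y) (vscale (- psign (a * b)) (nab W Y X))"
  using levi_civita[unfolded levi_civita_def, THEN conjunct2, THEN spec, THEN spec, THEN spec, THEN mp, OF W]
    assms by blast

text \<open>Vanishing torsion writes the supercommutator as a combination of covariant derivatives,
  which are vector fields by the axioms of a connection; this replaces a verification of the Leibniz
  rule.\<close>

lemma vbracket_vf:
  assumes "X \<in> vf M W a" "Y \<in> vf M W b"
  shows "vbracket a b X Y \<in> vf M W (a + b)"
  unfolding torsion_free[OF assms]
  using nab_vf[OF assms] nab_vf[OF assms(2,1)] by (simp add: vf_vadd vf_vscale add.commute)

lemma vbracket_jacobi:
  assumes X: "X \<in> vf M W a" and Y: "Y \<in> vf M W b" and Z: "Z \<in> vf M W c"
  shows "vbracket (a + b) c (vbracket a b X Y) Z V f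
    + psign (a * (b + c)) *\<^sub>R vbracket (b + c) a (vbracket b c Y Z) X V f
    + psign (c * (a + b)) *\<^sub>R vbracket (c + a) b (vbracket c a Z X) Y V f = 0"
proof (cases "openin (base M) V \<and> V \<subseteq> W \<and> f \<in> sec M V")
  case True
  then have V: "openin (base M) V" "V \<subseteq> W" and f: "f \<in> sec M V"
    by auto
  note s = vf_sec[OF X V] vf_sec[OF Y V] vf_sec[OF Z V] subspace_scale[OF sec_subspace[OF V(1)]]
    subspace_diff[OF sec_subspace[OF V(1)]] subspace_neg[OF sec_subspace[OF V(1)]]
  note l = linear_on_diff_scale[OF vf_linear[OF X V] sec_subspace[OF V(1)]]
    linear_on_diff_scale[OF vf_linear[OF Y V] sec_subspace[OF V(1)]]
    linear_on_diff_scale[OF vf_linear[OF Z V] sec_subspace[OF V(1)]]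
  show ?thesis
    unfolding vbracket_def by (simp add: l s f algebra_simps)
next
  \<comment> \<open>Fields are total functions with default value 0, and the identity is later used
    as an equality of such functions, so it has to hold off the domain too.\<close>
  case False
  note z = vf_outside[OF X False] vf_outside[OF Y False] vf_outside[OF Z False]
    vf_zero[OF X] vf_zero[OF Y] vf_zero[OF Z]
  show ?thesis
    unfolding vbracket_def by (simp add: z)
qed

text \<open>Vanishing torsion, used twice, turns the derivative along [X, Y] into the double bracket
  [[X, Y], Z] plus second covariant derivatives along Z. In the cyclic sum all second derivatives
  cancel, and the Jacobi identity disposes of the double brackets.\<close>

lemma curvature_bianchi:
  assumes X: "X \<in> vf M W a" and Y: "Y \<in> vf M W b" and Z: "Z \<in> vf M W c"
  shows "vadd (curvature nab W a b X Y Z)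
     (vadd (vscale (psign (a * (b + c))) (curvature nab W b c Y Z X))
       (vscale (psign (c * (a + b))) (curvature nab W c a Z X Y))) = (\<lambda>V f. 0)"
proof (intro ext)
  fix V f
  note ts = vf_tangent_sheaf[OF W]
  have nb: "nab W (vbracket a b X Y) Z V f = vbracket (a + b) c (vbracket a b X Y) Z V f
      + psign ((a + b) * c) *\<^sub>R (nab W Z (nab W X Y) V f - psign (a * b) *\<^sub>R nab W Z (nab W Y X) V f)"
    if X: "X \<in> vf M W a" and Y: "Y \<in> vf M W b" and Z: "Z \<in> vf M W c" for X Y Z a b c
  proof -
    have 1: "nab W X Y \<in> tangent_sheaf M W" "nab W Y X \<in> tangent_sheaf M W" "Z \<in> tangent_sheaf M W"
      using ts[OF nab_vf[OF X Y]] ts[OF nab_vf[OF Y X]] ts[OF Z] .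
    have "nab W Z (vbracket a b X Y)
        = vadd (nab W Z (nab W X Y)) (vscale (- psign (a * b)) (nab W Z (nab W Y X)))"
      unfolding torsion_free[OF X Y]
      by (simp add: nab_vadd(2)[OF 1(1) tangent_sheaf_vscale[OF 1(2)] 1(3)] nab_vscale(2)[OF psign_unit(2) 1(2,3)])
    then show ?thesis
      unfolding torsion_free[OF vbracket_vf[OF X Y] Z] by (simp add: vadd_def vscale_def)
  qed
  show "vadd (curvature nab W a b X Y Z)
     (vadd (vscale (psign (a * (b + c))) (curvature nab W b c Y Z X))
       (vscale (psign (c * (a + b))) (curvature nab W c a Z X Y))) V f = 0"
    using vbracket_jacobi[OF X Y Z, of V f]
    by (simp add: curvature_def vadd_def vscale_def nb[OF X Y Z] nb[OF Y Z X] nb[OF Z X Y])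
      (cases a; cases b; cases c; simp add: algebra_simps)
qed

abbreviation functional :: "('s \<Rightarrow> real) \<Rightarrow> bool" where
  "functional F \<equiv> linear_on (sec M W) F"

lemma functional_body: "functional (\<lambda>f. body M W f o\<^sub>p)"
  using body_linear[OF W o_W] .

text \<open>Composition with a derivation keeps functionals within the class, so an identity proved
  for all functionals may be differentiated before it is evaluated at the base point.\<close>

lemma functional_comp:
  assumes "functional F" "X \<in> vf M W a"
  shows "functional (\<lambda>f. F (X W f))"
  using assms(1) vf_linear[OF assms(2) W order_refl] vf_sec[OF assms(2) W order_refl]
  by (simp add: linear_on_def)

lemma functional_vadd:
  assumes F: "functional F"
    and X: "X \<in> tangent_sheaf M W" and Y: "Y \<in> tangent_sheaf M W" and Z: "Z \<in> tangent_sheaf M W"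
  shows "F (g W (vadd X Y) Z) = F (g W X Z) + F (g W Y Z)"
    "F (g W Z (vadd X Y)) = F (g W Z X) + F (g W Z Y)"
  using linear_on_add[OF F] g_vadd[OF X Y Z] g_sec X Y Z by simp_all

lemma functional_vscale:
  assumes F: "functional F" and r: "r = 1 \<or> r = - 1"
    and X: "X \<in> tangent_sheaf M W" and Z: "Z \<in> tangent_sheaf M W"
  shows "F (g W (vscale r X) Z) = r * F (g W X Z)" "F (g W Z (vscale r X)) = r * F (g W Z X)"
  using linear_on_scale[OF F] g_vscale[OF r X Z] g_sec X Z by simp_all

lemma functional_super_sym:
  assumes F: "functional F" and X: "X \<in> vf M W a" and Y: "Y \<in> vf M W b"
  shows "F (g W X Y) = psign (a * b) * F (g W Y X)"
  using linear_on_scale[OF F g_sec] vf_tangent_sheaf[OF W] g_super_sym[OF X Y] X Y by simp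

lemma functional_compatible:
  assumes F: "functional F" and X: "X \<in> vf M W a" and Y: "Y \<in> vf M W b" and Z: "Z \<in> vf M W c"
  shows "F (X W (g W Y Z)) = F (g W (nab W X Y) Z) + psign (a * b) * F (g W Y (nab W X Z))"
proof -
  have "g W (nab W X Y) Z \<in> sec M W" "g W Y (nab W X Z) \<in> sec M W"
    using g_sec vf_tangent_sheaf[OF W] nab_vf X Y Z by metis+
  then show ?thesis
    by (simp add: metric_compatible[OF X Y Z] linear_on_add[OF F] linear_on_scale[OF F]
        subspace_scale[OF sec_subspace[OF W]])
qed

lemma curvature_vf:
  assumes X: "X \<in> vf M W a" and Y: "Y \<in> vf M W b" and Z: "Z \<in> vf M W c"
  shows "curvature nab W a b X Y Z \<in> vf M W (a + b + c)"
  using nab_vf[OF vbracket_vf[OF X Y] Z] nab_vf[OF X nab_vf[OF Y Z]] nab_vf[OF Y nab_vf[OF X Z]]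
  by (simp add: curvature_def vf_vadd vf_vscale ac_simps)

lemma functional_curvature:
  assumes F: "functional F"
    and X: "X \<in> vf M W a" and Y: "Y \<in> vf M W b" and Z: "Z \<in> vf M W c" and T: "T \<in> vf M W d"
  shows "F (g W (curvature nab W a b X Y Z) T) = F (g W (nab W (vbracket a b X Y) Z) T)
      - F (g W (nab W X (nab W Y Z)) T) + psign (a * b) * F (g W (nab W Y (nab W X Z)) T)"
    and "F (g W T (curvature nab W a b X Y Z)) = F (g W T (nab W (vbracket a b X Y) Z))
      - F (g W T (nab W X (nab W Y Z))) + psign (a * b) * F (g W T (nab W Y (nab W X Z)))"
proof -
  note ts = vf_tangent_sheaf[OF W nab_vf[OF vbracket_vf[OF X Y] Z]]
    vf_tangent_sheaf[OF W nab_vf[OF X nab_vf[OF Y Z]]] vf_tangent_sheaf[OF W nab_vf[OF Y nab_vf[OF X Z]]]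
    vf_tangent_sheaf[OF W T]
  show "F (g W (curvature nab W a b X Y Z) T) = F (g W (nab W (vbracket a b X Y) Z) T)
      - F (g W (nab W X (nab W Y Z)) T) + psign (a * b) * F (g W (nab W Y (nab W X Z)) T)"
    and "F (g W T (curvature nab W a b X Y Z)) = F (g W T (nab W (vbracket a b X Y) Z))
      - F (g W T (nab W X (nab W Y Z))) + psign (a * b) * F (g W T (nab W Y (nab W X Z)))"
    unfolding curvature_def
    by (simp_all add: functional_vadd[OF F] functional_vscale[OF F] psign_unit ts tangent_sheaf_vadd
        tangent_sheaf_vscale)
qed

text \<open>The arguments carry their parities because a field does not determine its own: the zero
  field is both even and odd. With pairs, parity becomes a function, as
  \<open>curvature_pair_symmetry\<close> requires.\<close>

definition Rm :: "bit \<times> ('p, 's) vfield \<Rightarrow> bit \<times> ('p, 's) vfield \<Rightarrow> bit \<times> ('p, 's) vfield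
    \<Rightarrow> bit \<times> ('p, 's) vfield \<Rightarrow> real" where
  "Rm x y z t = body M W (g W (curvature nab W (fst x) (fst y) (snd x) (snd y) (snd z)) (snd t)) o\<^sub>p"

abbreviation hvf :: "(bit \<times> ('p, 's) vfield) set" where
  "hvf \<equiv> {x. snd x \<in> vf M W (fst x)}"

lemma Rm_skew12:
  assumes S: "x \<in> hvf" "y \<in> hvf" "z \<in> hvf" "t \<in> hvf"
  shows "Rm y x z t = - psign (fst x * fst y) * Rm x y z t"
proof -
  obtain a X b Y c Z d T where e: "x = (a, X)" "y = (b, Y)" "z = (c, Z)" "t = (d, T)"
    by (cases x, cases y, cases z, cases t) blast
  have X: "X \<in> vf M W a" and Y: "Y \<in> vf M W b" and Z: "Z \<in> vf M W c" and T: "T \<in> vf M W d"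
    using S e by auto
  note ts = vf_tangent_sheaf[OF W]
  have "vbracket b a Y X = vscale (- psign (a * b)) (vbracket a b X Y)"
    by (cases a; cases b; simp add: vbracket_def vscale_def fun_eq_iff)
  then have "nab W (vbracket b a Y X) Z = vscale (- psign (a * b)) (nab W (vbracket a b X Y) Z)"
    using nab_vscale(1)[OF psign_unit(2) ts[OF vbracket_vf[OF X Y]] ts[OF Z]] by simp
  then show ?thesis
    using functional_vscale(1)[OF functional_body psign_unit(2) ts[OF nab_vf[OF vbracket_vf[OF X Y] Z]] ts[OF T]]
    by (simp add: Rm_def e functional_curvature(1)[OF functional_body X Y Z T]
        functional_curvature(1)[OF functional_body Y X Z T])
qed

text \<open>The function g(Z, T) is differentiated by [X, Y] in two ways: directly by compatibility,
  and as a supercommutator of two derivations. In the second computation the products of two first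
  derivatives cancel; comparing both shows that curvature is skew with respect to
  \<open>g\<close>.\<close>

lemma Rm_skew34:
  assumes S: "x \<in> hvf" "y \<in> hvf" "z \<in> hvf" "t \<in> hvf"
  shows "Rm x y z t = - psign (fst z * fst t) * Rm x y t z"
proof -
  obtain a X b Y c Z d T where e: "x = (a, X)" "y = (b, Y)" "z = (c, Z)" "t = (d, T)"
    by (cases x, cases y, cases z, cases t) blast
  have X: "X \<in> vf M W a" and Y: "Y \<in> vf M W b" and Z: "Z \<in> vf M W c" and T: "T \<in> vf M W d"
    using S e by auto
  let ?F = "\<lambda>f. body M W f o\<^sub>p"
  note F = functional_body
  have nn: "?F (X W (Y W (g W Z T))) = ?F (g W (nab W X (nab W Y Z)) T)
      + psign (a * (b + c)) * ?F (g W (nab W Y Z) (nab W X T))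
      + psign (b * c) * (?F (g W (nab W X Z) (nab W Y T)) + psign (a * c) * ?F (g W Z (nab W X (nab W Y T))))"
    if X: "X \<in> vf M W a" and Y: "Y \<in> vf M W b" for X Y a b
  proof -
    have "?F (X W (Y W (g W Z T))) = ?F (X W (g W (nab W Y Z) T))
        + psign (b * c) * ?F (X W (g W Z (nab W Y T)))"
      by (rule functional_compatible[OF functional_comp[OF F X] Y Z T])
    then show ?thesis
      by (simp add: functional_compatible[OF F X nab_vf[OF Y Z] T] functional_compatible[OF F X Z nab_vf[OF Y T]])
  qed
  have s: "Y W (g W Z T) \<in> sec M W" "X W (g W Z T) \<in> sec M W"
    "X W (Y W (g W Z T)) \<in> sec M W" "Y W (X W (g W Z T)) \<in> sec M W"
    using vf_sec[OF X W order_refl] vf_sec[OF Y W order_refl] g_sec vf_tangent_sheaf[OF W] Z T by auto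
  have "?F (vbracket a b X Y W (g W Z T)) = ?F (X W (Y W (g W Z T))) - psign (a * b) * ?F (Y W (X W (g W Z T)))"
    unfolding vbracket_def
    using linear_on_diff_scale[OF F sec_subspace[OF W] s(3,4)] by simp
  then have "?F (g W (curvature nab W a b X Y Z) T)
      = - psign ((a + b) * c) * ?F (g W Z (curvature nab W a b X Y T))"
    unfolding functional_compatible[OF F vbracket_vf[OF X Y] Z T] nn[OF X Y] nn[OF Y X]
      functional_curvature(1)[OF F X Y Z T] functional_curvature(2)[OF F X Y T Z]
    by (cases a; cases b; cases c; simp)
  then show ?thesis
    using functional_super_sym[OF F Z curvature_vf[OF X Y T]]
    by (cases a; cases b; cases c; cases d; simp add: Rm_def e)
qed

lemma Rm_bianchi:
  assumes S: "x \<in> hvf" "y \<in> hvf" "z \<in> hvf" "t \<in> hvf"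
  shows "Rm x y z t + psign (fst x * (fst y + fst z)) * Rm y z x t
    + psign (fst z * (fst x + fst y)) * Rm z x y t = 0"
proof -
  obtain a X b Y c Z d T where e: "x = (a, X)" "y = (b, Y)" "z = (c, Z)" "t = (d, T)"
    by (cases x, cases y, cases z, cases t) blast
  have X: "X \<in> vf M W a" and Y: "Y \<in> vf M W b" and Z: "Z \<in> vf M W c" and T: "T \<in> vf M W d"
    using S e by auto
  note ts = vf_tangent_sheaf[OF W]
  note c = ts[OF curvature_vf[OF X Y Z]] ts[OF curvature_vf[OF Y Z X]] ts[OF curvature_vf[OF Z X Y]] ts[OF T]
  have "body M W (g W (\<lambda>V f. 0) T) o\<^sub>p = 0"
    using functional_vadd(1)[OF functional_body zero_tangent_sheaf zero_tangent_sheaf c(4)]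
    by (simp add: vadd_zero)
  then show ?thesis
    using c unfolding curvature_bianchi[OF X Y Z, symmetric]
    by (simp add: functional_vadd[OF functional_body] functional_vscale[OF functional_body] psign_unit
        tangent_sheaf_vadd tangent_sheaf_vscale Rm_def e)
qed

section \<open>Dependence of the curvature on values at the base point\<close>

lemma o_topspace: "o\<^sub>p \<in> topspace (base M)"
  using o_W openin_subset[OF W] by blast

lemma induced_form_at:
  obtains B where "induced_form M g o\<^sub>p B"
  using metric[unfolded graded_riemannian_metric_def, THEN conjunct2, THEN bspec, OF o_topspace] that
  by (elim exE conjE)

lemma body_g_value:
  assumes "induced_form M g o\<^sub>p B" "X \<in> tangent_sheaf M W" "Y \<in> tangent_sheaf M W"
  shows "body M W (g W X Y) o\<^sub>p = B (value_at M W X o\<^sub>p) (value_at M W Y o\<^sub>p)"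
  using assms(1)[unfolded induced_form_def, THEN conjunct2, THEN spec, THEN mp, OF conjI[OF W o_W]] assms(2,3)
  by blast

lemma body_g_cong:
  assumes X: "X \<in> tangent_sheaf M W" and Y: "Y \<in> tangent_sheaf M W" and Y': "Y' \<in> tangent_sheaf M W"
    and eq: "value_at M W Y o\<^sub>p = value_at M W Y' o\<^sub>p"
  shows "body M W (g W X Y) o\<^sub>p = body M W (g W X Y') o\<^sub>p" "body M W (g W Y X) o\<^sub>p = body M W (g W Y' X) o\<^sub>p"
proof -
  obtain B where "induced_form M g o\<^sub>p B"
    by (rule induced_form_at)
  then show "body M W (g W X Y) o\<^sub>p = body M W (g W X Y') o\<^sub>p" "body M W (g W Y X) o\<^sub>p = body M W (g W Y' X) o\<^sub>p"
    using X Y Y' eq by (simp_all add: body_g_value)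
qed

lemma Rm_pair_symmetry:
  assumes S: "x \<in> hvf" "y \<in> hvf" "z \<in> hvf" "t \<in> hvf"
  shows "Rm x y z t = psign ((fst x + fst y) * (fst z + fst t)) * Rm z t x y"
proof (rule curvature_pair_symmetry[where S = hvf])
qed (rule Rm_skew12 Rm_skew34 Rm_bianchi; assumption | rule S)+

lemma Rm_cong:
  assumes S: "x \<in> hvf" "y \<in> hvf" "z \<in> hvf" "t \<in> hvf" "x' \<in> hvf" "y' \<in> hvf" "z' \<in> hvf" "t' \<in> hvf"
    and par: "fst x = fst x'" "fst y = fst y'" "fst z = fst z'" "fst t = fst t'"
    and val: "value_at M W (snd x) o\<^sub>p = value_at M W (snd x') o\<^sub>p"
      "value_at M W (snd y) o\<^sub>p = value_at M W (snd y') o\<^sub>p"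
      "value_at M W (snd z) o\<^sub>p = value_at M W (snd z') o\<^sub>p"
      "value_at M W (snd t) o\<^sub>p = value_at M W (snd t') o\<^sub>p"
  shows "Rm x y z t = Rm x' y' z' t'"
proof -
  have slot4: "Rm x y z t = Rm x y z t'"
    if "x \<in> hvf" "y \<in> hvf" "z \<in> hvf" "t \<in> hvf" "t' \<in> hvf" "fst t = fst t'"
      "value_at M W (snd t) o\<^sub>p = value_at M W (snd t') o\<^sub>p" for x y z t t'
  proof -
    note ts = vf_tangent_sheaf[OF W]
    show ?thesis
      unfolding Rm_def
      by (rule body_g_cong(1)[OF ts[OF curvature_vf] ts ts]) (use that in auto)
  qed
  have slot3: "Rm x y z t = Rm x y z' t"
    if "x \<in> hvf" "y \<in> hvf" "z \<in> hvf" "z' \<in> hvf" "t \<in> hvf" "fst z = fst z'"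
      "value_at M W (snd z) o\<^sub>p = value_at M W (snd z') o\<^sub>p" for x y z z' t
    using Rm_skew34[of x y z t] Rm_skew34[of x y z' t] slot4[of x y t z z'] that by simp
  have "Rm x y z t = Rm x y z' t'"
    using slot3[OF S(1,2,3,7,4) par(3) val(3)] slot4[OF S(1,2,7,4,8) par(4) val(4)] by simp
  also have "\<dots> = Rm x' y' z' t'"
    using Rm_pair_symmetry[OF S(1,2,7,8)] Rm_pair_symmetry[OF S(5,6,7,8)]
      slot3[OF S(7,8,1,5,2) par(1) val(1)] slot4[OF S(7,8,5,2,6) par(2) val(2)] par by simp
  finally show ?thesis .
qed

end

section \<open>Killing fields of a homogeneous superspace\<close>

text \<open>Once all parities are split, these rules evaluate the signs and leave linear arithmetic
  in which the remaining products of fields are atoms.\<close>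

lemmas sign_simps = psign_0 psign_1 mult_zero_left mult_zero_right mult_1 mult_1_right
  bit_one_plus_one add_0 add_0_right mult_minus_left mult_minus_right minus_minus distrib_left

text \<open>The infinitesimal picture of a homogeneous superspace: group, action and quotient are
  represented by \<open>dag\<close>, whose values at the base point exhaust the tangent space and
  vanish on \<open>k\<close>.\<close>

locale killing_fields = levi_civita_smfd M p q g nab W o\<^sub>p
  for M :: "('p, 's::real_algebra) superspace" and p q g nab W and o\<^sub>p :: 'p +
  fixes P :: "bit \<Rightarrow> 'a::real_vector set" and br :: "'a \<Rightarrow> 'a \<Rightarrow> 'a"
    and dag :: "'a \<Rightarrow> ('p, 's) vfield" and k :: "'a set"
  assumes lie: "lie_superalgebra scaleR P br"
    and dag_vf: "X \<in> P a \<Longrightarrow> dag X \<in> vf M (topspace (base M)) a"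
    and dag_add: "dag (X + Y) = vadd (dag X) (dag Y)"
    and dag_scale: "dag (r *\<^sub>R X) = vscale r (dag X)"
    and dag_bracket: "X \<in> P a \<Longrightarrow> Y \<in> P b \<Longrightarrow> vbracket a b (dag X) (dag Y) = vscale (- 1) (dag (br X Y))"
    and killing: "X \<in> P a \<Longrightarrow> \<eta> \<in> vf M W b \<Longrightarrow> \<zeta> \<in> vf M W c
      \<Longrightarrow> dag X W (g W \<eta> \<zeta>) = g W (vbracket a b (vres (dag X) W) \<eta>) \<zeta>
            + psign (a * b) *\<^sub>R g W \<eta> (vbracket a c (vres (dag X) W) \<zeta>)"
    and transitive: "tangent_space M o\<^sub>p \<subseteq> range (\<lambda>X. value_at M (topspace (base M)) (dag X) o\<^sub>p)"
    and stabiliser: "A \<in> k \<Longrightarrow> value_at M (topspace (base M)) (dag A) o\<^sub>p = (\<lambda>V f. 0)"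
begin

section \<open>Fundamental fields and the Koszul formula\<close>

lemma W_top: "W \<subseteq> topspace (base M)" and open_top: "openin (base M) (topspace (base M))"
  using openin_subset[OF W] by auto

lemma br_add: "br X (Y + Z) = br X Y + br X Z"
proof -
  have "Vector_Spaces.linear scaleR scaleR (br X)"
    using lie unfolding lie_superalgebra_def by blast
  then show ?thesis
    unfolding module_hom_iff_linear[symmetric] by (rule module_hom.add)
qed

lemma br_in: "X \<in> P a \<Longrightarrow> Y \<in> P b \<Longrightarrow> br X Y \<in> P (a + b)"
  and br_super_skew: "X \<in> P a \<Longrightarrow> Y \<in> P b \<Longrightarrow> br X Y = - psign (a * b) *\<^sub>R br Y X"
  and br_jacobi: "X \<in> P a \<Longrightarrow> Y \<in> P b \<Longrightarrow> br X (br Y Z) = br (br X Y) Z + psign (a * b) *\<^sub>R br Y (br X Z)"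
  using lie unfolding lie_superalgebra_def by blast+

lemma P_decompose:
  obtains X0 X1 where "X = X0 + X1" "X0 \<in> P 0" "X1 \<in> P 1"
proof -
  have "\<forall>x. \<exists>y\<in>P 0. \<exists>z\<in>P 1. x = y + z"
    using lie unfolding lie_superalgebra_def super_vector_space_def by (elim conjE)
  then show thesis
    using that by blast
qed

text \<open>The extensions in the claim live on \<open>W\<close> only, so the fields that replace
  them must be restricted to \<open>W\<close>.\<close>

definition D :: "'a \<Rightarrow> ('p, 's) vfield" where
  "D X = vres (dag X) W"

lemma D_vf: "X \<in> P a \<Longrightarrow> D X \<in> vf M W a"
  unfolding D_def using vf_vres[OF dag_vf W W_top] .

lemma D_add: "D (X + Y) = vadd (D X) (D Y)"
  by (simp add: D_def dag_add vadd_def vres_def fun_eq_iff)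

lemma D_minus: "D (- X) = vscale (- 1) (D X)"
  using dag_scale[of "- 1" X] by (simp add: D_def vscale_def vres_def fun_eq_iff)

lemma dag_tangent_sheaf: "dag X \<in> tangent_sheaf M (topspace (base M))"
proof -
  obtain X0 X1 where "X = X0 + X1" "X0 \<in> P 0" "X1 \<in> P 1"
    by (rule P_decompose)
  then show ?thesis
    using dag_vf dag_add unfolding tangent_sheaf_def by blast
qed

lemma D_tangent_sheaf: "D X \<in> tangent_sheaf M W"
  unfolding D_def using tangent_sheaf_vres[OF dag_tangent_sheaf W W_top] .

lemma D_bracket: "X \<in> P a \<Longrightarrow> Y \<in> P b \<Longrightarrow> vbracket a b (D X) (D Y) = vscale (- 1) (D (br X Y))"
  using dag_bracket[of X a Y b] by (auto simp: D_def vbracket_def vscale_def vres_def fun_eq_iff)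

lemma D_value: "value_at M W (D X) o\<^sub>p = value_at M (topspace (base M)) (dag X) o\<^sub>p"
  unfolding D_def using value_at_vres[OF open_top W W_top o_W dag_tangent_sheaf] .

abbreviation G :: "'a \<Rightarrow> 'a \<Rightarrow> 's" where
  "G X Y \<equiv> g W (D X) (D Y)"

lemma functional_G:
  assumes F: "functional F"
  shows "F (G (X + Y) Z) = F (G X Z) + F (G Y Z)" "F (G Z (X + Y)) = F (G Z X) + F (G Z Y)"
    "F (G (- X) Z) = - F (G X Z)" "F (G Z (- X)) = - F (G Z X)"
  using functional_vadd[OF F D_tangent_sheaf D_tangent_sheaf D_tangent_sheaf]
    functional_vscale[OF F, of "- 1", OF _ D_tangent_sheaf D_tangent_sheaf]
  by (simp_all add: D_add D_minus)

text \<open>Both minus signs come from \<open>dag\<close> being an anti-homomorphism: the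
  supercommutators in the Killing equation are minus the fundamental fields of the brackets.\<close>

lemma functional_killing:
  assumes F: "functional F" and X: "X \<in> P a" and Y: "Y \<in> P b" and Z: "Z \<in> P c"
  shows "F (D X W (G Y Z)) = - F (G (br X Y) Z) - psign (a * b) * F (G Y (br X Z))"
proof -
  have "D X W (G Y Z) = G (- br X Y) Z + psign (a * b) *\<^sub>R G Y (- br X Z)"
    using killing[OF X D_vf[OF Y] D_vf[OF Z]] D_bracket[OF X Y] D_bracket[OF X Z]
    by (simp add: D_minus) (simp add: D_def vres_def)
  then show ?thesis
    by (simp add: linear_on_add[OF F] linear_on_scale[OF F] g_sec D_tangent_sheaf
        subspace_scale[OF sec_subspace[OF W]] functional_G[OF F])
qed

text \<open>Three torsion equations and three compatibility equations determine the six products of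
  a covariant derivative of one of the three fields along another with the third. No derivative of
  the metric survives, as the Killing equation has replaced it by brackets.\<close>

lemma functional_koszul_homogeneous:
  assumes F: "functional F" and X: "X \<in> P a" and Y: "Y \<in> P b" and Z: "Z \<in> P c"
  shows "2 * F (g W (nab W (D X) (D Y)) (D Z))
    = - F (G (br X Y) Z) - psign (a * b) * F (G Y (br X Z)) - F (G X (br Y Z))"
proof -
  have t: "- F (g W (D (br X Y)) (D Z))
      = F (g W (nab W (D X) (D Y)) (D Z)) - psign (a * b) * F (g W (nab W (D Y) (D X)) (D Z))"
    if X: "X \<in> P a" and Y: "Y \<in> P b" and Z: "Z \<in> P c" for X Y Z a b c
  proof -
    note ts = vf_tangent_sheaf[OF W nab_vf[OF D_vf[OF X] D_vf[OF Y]]]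
      vf_tangent_sheaf[OF W nab_vf[OF D_vf[OF Y] D_vf[OF X]]]
    have "F (g W (vbracket a b (D X) (D Y)) (D Z))
        = F (g W (nab W (D X) (D Y)) (D Z)) - psign (a * b) * F (g W (nab W (D Y) (D X)) (D Z))"
      unfolding torsion_free[OF D_vf[OF X] D_vf[OF Y]]
      by (simp add: functional_vadd[OF F] functional_vscale[OF F] psign_unit ts tangent_sheaf_vscale D_tangent_sheaf)
    then show ?thesis
      by (simp add: D_bracket[OF X Y] functional_vscale[OF F] D_tangent_sheaf)
  qed
  \<comment> \<open>The Killing equation and compatibility compute the same derivative of g(Y, Z).
    Supersymmetry moves the second covariant derivative into the first slot, so that all unknowns
    have one shape.\<close>
  have c: "- F (G (br X Y) Z) - psign (a * b) * F (G Y (br X Z))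
      = F (g W (nab W (D X) (D Y)) (D Z)) + psign (a * b) * psign (b * (a + c)) * F (g W (nab W (D X) (D Z)) (D Y))"
    if X: "X \<in> P a" and Y: "Y \<in> P b" and Z: "Z \<in> P c" for X Y Z a b c
    using functional_compatible[OF F D_vf[OF X] D_vf[OF Y] D_vf[OF Z]] functional_killing[OF F X Y Z]
      functional_super_sym[OF F D_vf[OF Y] nab_vf[OF D_vf[OF X] D_vf[OF Z]]] by simp
  \<comment> \<open>All bracket terms of the six equations are reduced to three: [X, Y] against Z, Y
    against [X, Z], and X against [Y, Z].\<close>
  have s: "F (G (br Y X) Z) = - psign (a * b) * F (G (br X Y) Z)"
    "F (G (br X Z) Y) = psign (b * (a + c)) * F (G Y (br X Z))"
    "F (G (br Z X) Y) = - psign (a * c) * F (G (br X Z) Y)"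
    "F (G (br Y Z) X) = psign (a * (b + c)) * F (G X (br Y Z))"
    "F (G (br Z Y) X) = - psign (b * c) * F (G (br Y Z) X)"
    "F (G Y (br Z X)) = - psign (a * c) * F (G Y (br X Z))"
    "F (G X (br Z Y)) = - psign (b * c) * F (G X (br Y Z))"
    "F (G Z (br X Y)) = psign (c * (a + b)) * F (G (br X Y) Z)"
  proof -
    have sk: "F (G (br Y X) Z) = - psign (a * b) * F (G (br X Y) Z)"
      "F (G Z (br Y X)) = - psign (a * b) * F (G Z (br X Y))"
      if "X \<in> P a" "Y \<in> P b" for X Y Z a b
      using br_super_skew[OF that(2,1)] functional_G(3,4)[OF F]
      by (induct a; induct b; simp)+
    show "F (G (br Y X) Z) = - psign (a * b) * F (G (br X Y) Z)"
      "F (G (br Z X) Y) = - psign (a * c) * F (G (br X Z) Y)"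
      "F (G (br Z Y) X) = - psign (b * c) * F (G (br Y Z) X)"
      "F (G Y (br Z X)) = - psign (a * c) * F (G Y (br X Z))"
      "F (G X (br Z Y)) = - psign (b * c) * F (G X (br Y Z))"
      using sk[OF X Y] sk[OF X Z] sk[OF Y Z] by simp_all
    show "F (G (br X Z) Y) = psign (b * (a + c)) * F (G Y (br X Z))"
      "F (G (br Y Z) X) = psign (a * (b + c)) * F (G X (br Y Z))"
      "F (G Z (br X Y)) = psign (c * (a + b)) * F (G (br X Y) Z)"
      using functional_super_sym[OF F D_vf[OF br_in[OF X Z]] D_vf[OF Y]]
        functional_super_sym[OF F D_vf[OF br_in[OF Y Z]] D_vf[OF X]]
        functional_super_sym[OF F D_vf[OF Z] D_vf[OF br_in[OF X Y]]] by (simp_all add: mult.commute)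
  qed
  show ?thesis
    by (insert t[OF X Y Z] t[OF X Z Y] t[OF Y Z X] c[OF X Y Z] c[OF Y X Z] c[OF Z X Y] s,
        induct a; induct b; induct c)
      (simp_all (no_asm_use) only: sign_simps)
qed

text \<open>No sign in the formula involves the parity of Z, so additivity extends it from
  homogeneous Z to all Z.\<close>

lemma functional_koszul:
  assumes F: "functional F" and X: "X \<in> P a" and Y: "Y \<in> P b"
  shows "2 * F (g W (nab W (D X) (D Y)) (D Z))
    = - F (G (br X Y) Z) - psign (a * b) * F (G Y (br X Z)) - F (G X (br Y Z))"
proof -
  obtain Z0 Z1 where Z: "Z = Z0 + Z1" "Z0 \<in> P 0" "Z1 \<in> P 1"
    by (rule P_decompose)
  note ts = vf_tangent_sheaf[OF W nab_vf[OF D_vf[OF X] D_vf[OF Y]]]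
  show ?thesis
    using functional_koszul_homogeneous[OF F X Y Z(2)] functional_koszul_homogeneous[OF F X Y Z(3)]
    by (simp add: Z(1) D_add functional_vadd[OF F] ts D_tangent_sheaf tangent_sheaf_vadd br_add algebra_simps)
qed

text \<open>The scalar superproduct pulled back to the whole Lie superalgebra, so that brackets may
  be inserted without projecting them to \<open>m\<close>.\<close>

definition B :: "'a \<Rightarrow> 'a \<Rightarrow> real" where
  "B X Y = body M W (G X Y) o\<^sub>p"

lemma B_add: "B (X + Y) Z = B X Z + B Y Z" "B Z (X + Y) = B Z X + B Z Y"
  and B_minus: "B (- X) Z = - B X Z" "B Z (- X) = - B Z X"
  using functional_G[OF functional_body] by (simp_all add: B_def)

lemma B_diff: "B (X - Y) Z = B X Z - B Y Z" "B Z (X - Y) = B Z X - B Z Y"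
  using B_add(1)[of X "- Y" Z] B_add(2)[of Z X "- Y"] by (simp_all add: B_minus)

lemma B_psign: "B (psign u *\<^sub>R X) Z = psign u * B X Z" "B Z (psign u *\<^sub>R X) = psign u * B Z X"
  by (cases u; simp add: B_minus)+

lemma B_super_sym: "X \<in> P a \<Longrightarrow> Y \<in> P b \<Longrightarrow> B X Y = psign (a * b) * B Y X"
  unfolding B_def by (rule functional_super_sym[OF functional_body D_vf D_vf])

text \<open>The metrics over \<open>W\<close> and over the whole space factor through one and the
  same form on tangent vectors at the base point.\<close>

lemma scalar_superproduct_B: "scalar_superproduct M g dag o\<^sub>p X Y = B X Y"
proof -
  obtain b where b: "induced_form M g o\<^sub>p b"
    by (rule induced_form_at)
  have "body M (topspace (base M)) (g (topspace (base M)) (dag X) (dag Y)) o\<^sub>p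
      = b (value_at M (topspace (base M)) (dag X) o\<^sub>p) (value_at M (topspace (base M)) (dag Y) o\<^sub>p)"
    using b[unfolded induced_form_def, THEN conjunct2, THEN spec, THEN mp, OF conjI[OF open_top o_topspace]]
      dag_tangent_sheaf by blast
  then show ?thesis
    unfolding scalar_superproduct_def B_def body_g_value[OF b D_tangent_sheaf D_tangent_sheaf] D_value .
qed

lemma zero_field_D: "D 0 = (\<lambda>V f. 0)"
  using dag_scale[of 0 0] by (simp add: D_def vscale_def vres_def fun_eq_iff)

text \<open>At the base point the fundamental field of an element of \<open>k\<close> has the same
  value as that of 0, and \<open>B\<close> sees only values.\<close>

lemma B_stabiliser:
  assumes A: "A \<in> k"
  shows "B A X = 0" "B X A = 0"
proof -
  have "value_at M W (\<lambda>V f. 0) o\<^sub>p = (\<lambda>V f. 0)"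
    using linear_on_zero[OF body_linear subspace_0[OF sec_subspace]] W o_W
    by (auto simp: value_at_def fun_eq_iff openin_Int)
  then have "value_at M W (D A) o\<^sub>p = value_at M W (D 0) o\<^sub>p"
    by (simp add: D_value[of A] stabiliser[OF A] zero_field_D)
  then have "B A X = B 0 X" "B X A = B X 0"
    unfolding B_def by (rule body_g_cong[OF D_tangent_sheaf D_tangent_sheaf D_tangent_sheaf])+
  then show "B A X = 0" "B X A = 0"
    using B_minus(1)[of 0 X] B_minus(2)[of X 0] by simp_all
qed

end

locale complemented_killing_fields = killing_fields M p q g nab W o\<^sub>p P br dag k
  for M :: "('p, 's::real_algebra) superspace" and p q g nab W and o\<^sub>p :: 'p
    and P br dag and k :: "'a::real_vector set" +
  fixes m :: "'a set" and U :: "'a \<Rightarrow> 'a \<Rightarrow> 'a"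
  assumes k: "graded_subspace scaleR P k" and m: "graded_subspace scaleR P m"
    and km: "k \<inter> m = {0}" "\<exists>Y\<in>k. \<exists>Z\<in>m. X = Y + Z"
    and U: "X \<in> m \<inter> P a \<Longrightarrow> Y \<in> m \<inter> P b \<Longrightarrow> U X Y \<in> m \<inter> P (a + b)"
    and U_eq: "X \<in> m \<inter> P a \<Longrightarrow> Y \<in> m \<inter> P b \<Longrightarrow> Z \<in> m
      \<Longrightarrow> B (U X Y) Z = - B X (mpart k m (br Y Z)) - psign (a * b) * B Y (mpart k m (br X Z))"
begin

section \<open>Projection to the complement\<close>

lemma k_subspace: "subspace k" and m_subspace: "subspace m"
  and k_graded: "X \<in> k \<Longrightarrow> \<exists>Y\<in>k \<inter> P 0. \<exists>Z\<in>k \<inter> P 1. X = Y + Z"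
  and m_graded: "X \<in> m \<Longrightarrow> \<exists>Y\<in>m \<inter> P 0. \<exists>Z\<in>m \<inter> P 1. X = Y + Z"
  using k m by (simp_all add: graded_subspace_def subspace_raw_def)

lemma mpart_unique:
  assumes "Z \<in> m" "Z' \<in> m" "X - Z \<in> k" "X - Z' \<in> k"
  shows "Z = Z'"
proof -
  have "Z - Z' \<in> m"
    using subspace_diff[OF m_subspace] assms by blast
  moreover have "(X - Z') - (X - Z) \<in> k"
    using subspace_diff[OF k_subspace] assms by blast
  then have "Z - Z' \<in> k"
    by simp
  ultimately have "Z - Z' \<in> {0}"
    unfolding km(1)[symmetric] by blast
  then show ?thesis
    by simp
qed

lemma mpart: "mpart k m X \<in> m \<and> X - mpart k m X \<in> k"
proof -
  obtain Y Z where YZ: "Y \<in> k" "Z \<in> m" "X = Y + Z"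
    using km(2) by blast
  have "Z \<in> m \<and> X - Z \<in> k"
    using YZ by simp
  then show ?thesis
    unfolding mpart_def by (rule theI) (use \<open>Z \<in> m \<and> X - Z \<in> k\<close> mpart_unique in blast)
qed

lemma mpart_eqI: "Z \<in> m \<Longrightarrow> X - Z \<in> k \<Longrightarrow> mpart k m X = Z"
  using mpart[of X] mpart_unique by blast

text \<open>An element differs from its projection by an element of \<open>k\<close>. This
  reconciles the projected brackets of the claim with the Jacobi identity, which is available for
  the unprojected bracket.\<close>

lemma B_mpart: "B (mpart k m X) Y = B X Y" "B Y (mpart k m X) = B Y X"
  using B_stabiliser[of "X - mpart k m X" Y] mpart[of X] by (simp_all add: B_diff)

lemma P_subspace: "subspace (P a)" and P_disjoint: "P 0 \<inter> P 1 = {0}"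
proof -
  have "super_vector_space scaleR P"
    using lie unfolding lie_superalgebra_def by (elim conjE)
  then show "P 0 \<inter> P 1 = {0}" and "subspace (P a)"
    unfolding super_vector_space_def subspace_raw_def by blast+
qed

text \<open>Since \<open>k\<close> and \<open>m\<close> are both graded, the even and odd components
  of an element split separately, and uniqueness of both decompositions forces the projection to
  preserve parity.\<close>

lemma mpart_in:
  assumes X: "X \<in> P a"
  shows "mpart k m X \<in> P a"
proof -
  obtain Y0 Y1 where Y: "X - mpart k m X = Y0 + Y1" "Y0 \<in> k \<inter> P 0" "Y1 \<in> k \<inter> P 1"
    using k_graded mpart[of X] by blast
  obtain Z0 Z1 where Z: "mpart k m X = Z0 + Z1" "Z0 \<in> m \<inter> P 0" "Z1 \<in> m \<inter> P 1"
    using m_graded mpart[of X] by blast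
  have eq: "X = (Y0 + Z0) + (Y1 + Z1)"
    using Y(1) Z(1) by (simp add: algebra_simps)
  have s: "Y0 + Z0 \<in> P 0" "Y1 + Z1 \<in> P 1"
    using Y Z subspace_add[OF P_subspace] by auto
  show ?thesis
  proof (cases a)
    assume a: "a = 0"
    have "X - (Y0 + Z0) \<in> P 0"
      using subspace_diff[OF P_subspace] X a s by blast
    moreover have "X - (Y0 + Z0) = Y1 + Z1"
      using eq by simp
    ultimately have "Y1 + Z1 = 0"
      using P_disjoint s by auto
    then have "X = Y0 + Z0"
      using eq by simp
    then have "mpart k m X = Z0"
      using mpart_eqI[of Z0 X] Y Z by simp
    then show ?thesis
      using Z a by simp
  next
    assume a: "a = 1"
    have "X - (Y1 + Z1) \<in> P 1"
      using subspace_diff[OF P_subspace] X a s by blast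
    moreover have "X - (Y1 + Z1) = Y0 + Z0"
      using eq by simp
    ultimately have "Y0 + Z0 = 0"
      using P_disjoint s by auto
    then have "X = Y1 + Z1"
      using eq by simp
    then have "mpart k m X = Z1"
      using mpart_eqI[of Z1 X] Y Z by simp
    then show ?thesis
      using Z a by simp
  qed
qed

section \<open>Covariant derivatives and curvature at the base point\<close>

definition V :: "'a \<Rightarrow> 'a \<Rightarrow> 'a" where
  "V X Y = U X Y - mpart k m (br X Y)"

lemma V_in: "X \<in> m \<inter> P a \<Longrightarrow> Y \<in> m \<inter> P b \<Longrightarrow> V X Y \<in> m \<inter> P (a + b)"
  unfolding V_def
  using U mpart mpart_in br_in subspace_diff[OF m_subspace] subspace_diff[OF P_subspace] by (metis IntE IntI)

text \<open>Of the three Koszul terms, the two in which Z sits inside a bracket are exactly the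
  right hand side defining \<open>U\<close>; the third is minus the product of [X, Y] with
  Z.\<close>

lemma body_nab_V:
  assumes X: "X \<in> m \<inter> P a" and Y: "Y \<in> m \<inter> P b" and Z: "Z \<in> m"
  shows "2 * body M W (g W (nab W (D X) (D Y)) (D Z)) o\<^sub>p = B (V X Y) Z"
  using functional_koszul[OF functional_body, of X a Y b Z] U_eq[OF X Y Z] X Y
  by (simp add: V_def B_diff B_mpart) (simp add: B_def)

text \<open>By transitivity every tangent vector is the value of some fundamental field, and the
  \<open>k\<close>-component of its generator contributes nothing to that value.\<close>

lemma value_in_m:
  assumes "A \<in> tangent_sheaf M W"
  obtains N where "N \<in> m" "value_at M W A o\<^sub>p = value_at M W (D N) o\<^sub>p"
proof -
  obtain X where X: "value_at M W A o\<^sub>p = value_at M (topspace (base M)) (dag X) o\<^sub>p"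
    using value_at_tangent_space[OF W o_W assms] transitive by blast
  \<comment> \<open>\<open>value_at_vadd\<close> concerns homogeneous fields, hence the
    \<open>k\<close>-component is split off parity by parity.\<close>
  obtain Y0 Y1 where Y: "X - mpart k m X = Y0 + Y1" "Y0 \<in> k \<inter> P 0" "Y1 \<in> k \<inter> P 1"
    using k_graded mpart[of X] by blast
  obtain Z0 Z1 where Z: "mpart k m X = Z0 + Z1" "Z0 \<in> P 0" "Z1 \<in> P 1"
    by (rule P_decompose)
  have X_eq: "X = (Z0 + Y0) + (Z1 + Y1)"
    using Y(1) Z(1) by (simp add: algebra_simps)
  have k0: "value_at M W (D Y') o\<^sub>p = (\<lambda>V f. 0)" if "Y' \<in> k" for Y'
    using that by (simp add: D_value stabiliser)
  note v = value_at_vadd[OF W o_W]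
  have Z_Y: "Z0 + Y0 \<in> P 0" "Z1 + Y1 \<in> P 1"
    using Y Z subspace_add[OF P_subspace] by auto
  have "value_at M W (D ((Z0 + Y0) + (Z1 + Y1))) o\<^sub>p = value_at M W (D (Z0 + Z1)) o\<^sub>p"
    using Y(2,3) Z(2,3) Z_Y v[OF D_vf[OF Z_Y(1)] D_vf[OF Z_Y(2)]] v[OF D_vf[OF Z(2)] D_vf[OF Z(3)]]
      v[OF D_vf[OF Z(2)] D_vf, of Y0 0] v[OF D_vf[OF Z(3)] D_vf, of Y1 1]
    by (simp add: D_add[symmetric] k0)
  then have "value_at M W (D X) o\<^sub>p = value_at M W (D (mpart k m X)) o\<^sub>p"
    unfolding X_eq[symmetric] Z(1)[symmetric] .
  then show thesis
    using that mpart[of X] X D_value by metis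
qed

text \<open>
  The value of \<open>\<nabla>\<^bsub>Z\<^sup>\<dagger>\<^esub>T\<^sup>\<dagger>\<close> at the base point is that of \<open>N\<^sup>\<dagger>\<close> for some \<open>N \<in> m\<close>, and the Koszul formula
  evaluates \<open>\<nabla>\<^bsub>X\<^sup>\<dagger>\<^esub>Y\<^sup>\<dagger>\<close> against \<open>m\<close>; so the two factors can be computed one at a time, without
  inverting \<open>\<langle>\<cdot>,\<cdot>\<rangle>\<close>.
\<close>

lemma body_nab_nab:
  assumes X: "X \<in> m \<inter> P a" and Y: "Y \<in> m \<inter> P b" and Z: "Z \<in> m \<inter> P c" and T: "T \<in> m \<inter> P d"
  shows "4 * body M W (g W (nab W (D X) (D Y)) (nab W (D Z) (D T))) o\<^sub>p = B (V X Y) (V Z T)"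
proof -
  have D: "D X \<in> vf M W a" "D Y \<in> vf M W b" "D Z \<in> vf M W c" "D T \<in> vf M W d"
    using X Y Z T D_vf by auto
  note n = nab_vf[OF D(1,2)] nab_vf[OF D(3,4)]
  note ts = n[THEN vf_tangent_sheaf[OF W]]
  obtain N where N: "N \<in> m" "value_at M W (nab W (D Z) (D T)) o\<^sub>p = value_at M W (D N) o\<^sub>p"
    using value_in_m[OF ts(2)] .
  have "2 * body M W (g W (nab W (D X) (D Y)) (nab W (D Z) (D T))) o\<^sub>p
      = 2 * body M W (g W (nab W (D X) (D Y)) (D N)) o\<^sub>p"
    using body_g_cong(1)[OF ts(1,2) D_tangent_sheaf N(2)] by simp
  also have "\<dots> = B (V X Y) N"
    by (rule body_nab_V[OF X Y N(1)])
  also have "\<dots> = body M W (g W (D (V X Y)) (nab W (D Z) (D T))) o\<^sub>p"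
    using body_g_cong(1)[OF D_tangent_sheaf ts(2) D_tangent_sheaf N(2)] by (simp add: B_def)
  also have "\<dots> = psign ((a + b) * (c + d)) * body M W (g W (nab W (D Z) (D T)) (D (V X Y))) o\<^sub>p"
    using functional_super_sym[OF functional_body D_vf n(2)] V_in[OF X Y] by blast
  finally show ?thesis
    using body_nab_V[OF Z T, of "V X Y"] V_in[OF X Y] V_in[OF Z T]
      B_super_sym[of "V X Y" "a + b" "V Z T" "c + d"] by (cases "a + b"; cases "c + d"; simp)
qed

text \<open>The Koszul formula for J, K, L is differentiated along I, and the Killing equation
  evaluates each of its three terms by two brackets. Compatibility then subtracts the product of two
  covariant derivatives, known from \<open>body_nab_nab\<close>. The inner 2 is what is left of 4
  after the factor 2 of the Koszul formula.\<close>

lemma body_nab_nab_g: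
  assumes I: "I \<in> m \<inter> P i" and J: "J \<in> m \<inter> P j" and K: "K \<in> m \<inter> P l" and L: "L \<in> m \<inter> P n"
  shows "4 * body M W (g W (nab W (D I) (nab W (D J) (D K))) (D L)) o\<^sub>p
    = 2 * (B (br I (br J K)) L + psign (i * (j + l)) * B (br J K) (br I L)
         + psign (j * l) * (B (br I K) (br J L) + psign (i * l) * B K (br I (br J L)))
         + B (br I J) (br K L) + psign (i * j) * B J (br I (br K L)))
      - psign (i * (j + l)) * B (V J K) (V I L)"
proof -
  have P: "I \<in> P i" "J \<in> P j" "K \<in> P l" "L \<in> P n"
    using I J K L by auto
  note F = functional_comp[OF functional_body D_vf[OF P(1)]]
  note k = functional_killing[OF functional_body P(1)]
  have "body M W (D I W (g W (nab W (D J) (D K)) (D L))) o\<^sub>p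
      = body M W (g W (nab W (D I) (nab W (D J) (D K))) (D L)) o\<^sub>p
      + psign (i * (j + l)) * body M W (g W (nab W (D J) (D K)) (nab W (D I) (D L))) o\<^sub>p"
    using functional_compatible[OF functional_body D_vf[OF P(1)] nab_vf[OF D_vf[OF P(2)] D_vf[OF P(3)]] D_vf[OF P(4)]] .
  moreover have "2 * body M W (D I W (g W (nab W (D J) (D K)) (D L))) o\<^sub>p
      = B (br I (br J K)) L + psign (i * (j + l)) * B (br J K) (br I L)
         + psign (j * l) * (B (br I K) (br J L) + psign (i * l) * B K (br I (br J L)))
         + B (br I J) (br K L) + psign (i * j) * B J (br I (br K L))"
    using functional_koszul[OF F P(2,3), of L]
    by (simp add: k[OF br_in[OF P(2,3)] P(4)] k[OF P(3) br_in[OF P(2,4)]] k[OF P(2) br_in[OF P(3,4)]]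
        B_def algebra_simps)
  ultimately show ?thesis
    using body_nab_nab[OF J K I L]
    by - (induct i; induct j; induct l; simp (no_asm_use) only: sign_simps; linarith)
qed

text \<open>The source of the nested projected brackets: in the expanded product, each cross term of
  \<open>U\<close> with a projected bracket is evaluated by the defining equation of
  \<open>U\<close>, tested against that bracket. The signs only rearrange the arguments into the
  order of the final formula.\<close>

lemma B_V_V:
  assumes I: "I \<in> m \<inter> P i" and J: "J \<in> m \<inter> P j" and K: "K \<in> m \<inter> P l" and L: "L \<in> m \<inter> P n"
  defines "JK \<equiv> mpart k m (br J K)" and "IL \<equiv> mpart k m (br I L)"
  shows "B (V J K) (V I L) = B (U J K) (U I L) + B (br J K) (br I L)
    + B J (br K IL) + psign (j * l + l * (j + i + n)) * B (br J IL) K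
    - psign (i * (j + l)) * B I (br JK L) + psign (i * (j + l)) * B (br I JK) L"
proof -
  have P: "I \<in> P i" "J \<in> P j" "K \<in> P l" "L \<in> P n"
    using I J K L by auto
  have JK: "JK \<in> m" "JK \<in> P (j + l)" and IL: "IL \<in> m" "IL \<in> P (i + n)"
    unfolding JK_def IL_def using mpart mpart_in br_in P by auto
  have 1: "B (U J K) IL = - B J (br K IL) - psign (j * l) * B K (br J IL)"
    using U_eq[OF J K IL(1)] by (simp add: B_mpart)
  have 2: "B (U I L) JK = - B I (br L JK) - psign (i * n) * B L (br I JK)"
    using U_eq[OF I L JK(1)] by (simp add: B_mpart)
  have 3: "B JK (U I L) = psign ((j + l) * (i + n)) * B (U I L) JK"
    using B_super_sym[OF JK(2)] U[OF I L] by blast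
  have 4: "B K (br J IL) = psign (l * (j + (i + n))) * B (br J IL) K"
    using B_super_sym[OF P(3) br_in[OF P(2) IL(2)]] .
  have 5: "B I (br L JK) = - psign (n * (j + l)) * B I (br JK L)"
    using br_super_skew[OF P(4) JK(2)] by (cases n; cases "j + l"; simp add: B_minus)
  have 6: "B L (br I JK) = psign (n * (i + (j + l))) * B (br I JK) L"
    using B_super_sym[OF P(4) br_in[OF P(1) JK(2)]] .
  have 7: "B (V J K) (V I L) = B (U J K) (U I L) - B (U J K) IL - B JK (U I L) + B (br J K) (br I L)"
    by (simp add: V_def JK_def[symmetric] IL_def[symmetric] B_diff) (simp add: JK_def IL_def B_mpart)
  show ?thesis
    unfolding 7 3 1 2 4 5 6
    by (induct i; induct j; induct l; induct n; simp)
qed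

text \<open>The coefficients result from cancellation: [I, J] against [K, L] collects 2 - 2 - 2 from
  the three terms of the curvature, while [J, K] against [I, L] collects, up to its sign, -2 + 2
  from the derivatives of the Koszul formula and 1 from \<open>B_V_V\<close>.\<close>

lemma curvature_at_base_point:
  assumes I: "I \<in> m \<inter> P i" and J: "J \<in> m \<inter> P j" and K: "K \<in> m \<inter> P l" and L: "L \<in> m \<inter> P n"
  defines "brm \<equiv> \<lambda>X Y. mpart k m (br X Y)"
  shows "4 * body M W (g W (curvature nab W i j (D I) (D J) (D K)) (D L)) o\<^sub>p =
    - 2 * B (brm I J) (brm K L)
    + psign (i * (j + l)) * B (brm J K) (brm I L)
    - psign (j * l) * B (brm I K) (brm J L)
    - B I (brm (brm J K) L)
    + B (brm I (brm J K)) L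
    + psign (i * j) * B J (brm (brm I K) L)
    + psign (j * l) * B (brm (brm I K) J) L
    + psign (i * (j + l)) * B J (brm K (brm I L))
    + psign (i * j + l * n) * B (brm J (brm I L)) K
    - psign (j * l) * B I (brm K (brm J L))
    - psign (l * n) * B (brm I (brm J L)) K
    + 2 * B I (brm J (br K L))
    - 2 * psign (i * j) * B J (brm I (br K L))
    + psign (i * (j + l)) * B (U J K) (U I L)
    - psign (j * l) * B (U I K) (U J L)"
proof -
  have P: "I \<in> P i" "J \<in> P j" "K \<in> P l" "L \<in> P n"
    using I J K L by auto
  let ?b = "\<lambda>f. body M W f o\<^sub>p"
  have curv: "?b (g W (curvature nab W i j (D I) (D J) (D K)) (D L))
      = - ?b (g W (nab W (D (br I J)) (D K)) (D L))
        - ?b (g W (nab W (D I) (nab W (D J) (D K))) (D L))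
        + psign (i * j) * ?b (g W (nab W (D J) (nab W (D I) (D K))) (D L))"
  proof -
    have "nab W (vbracket i j (D I) (D J)) (D K) = vscale (- 1) (nab W (D (br I J)) (D K))"
      by (simp add: D_bracket[OF P(1,2)] nab_vscale D_tangent_sheaf)
    then show ?thesis
      using vf_tangent_sheaf[OF W nab_vf[OF D_vf[OF br_in[OF P(1,2)]] D_vf[OF P(3)]]]
      by (simp add: functional_curvature(1)[OF functional_body D_vf[OF P(1)] D_vf[OF P(2)] D_vf[OF P(3)] D_vf[OF P(4)]]
          functional_vscale[OF functional_body] D_tangent_sheaf)
  qed
  \<comment> \<open>Here [I, J] need not lie in \<open>m\<close>, so the Koszul formula is used for
    the whole algebra instead of \<open>body_nab_V\<close>.\<close>
  have kos: "2 * ?b (g W (nab W (D (br I J)) (D K)) (D L))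
      = - B (br (br I J) K) L - psign ((i + j) * l) * B K (br (br I J) L) - B (br I J) (br K L)"
    using functional_koszul[OF functional_body br_in[OF P(1,2)] P(3), of L] by (simp add: B_def)
  note nn = body_nab_nab_g[OF I J K L, unfolded B_V_V[OF I J K L]]
    body_nab_nab_g[OF J I K L, unfolded B_V_V[OF J I K L]]
  \<comment> \<open>With these substitutions the unprojected triple brackets with inner bracket
    [I, J], [I, K], [J, K], [I, L] or [J, L] cancel; only those containing [K, L] remain, which is
    why the formula has the full bracket exactly there.\<close>
  have jac: "B (br I (br J K)) L = B (br (br I J) K) L + psign (i * j) * B (br J (br I K)) L"
    "B K (br I (br J L)) = B K (br (br I J) L) + psign (i * j) * B K (br J (br I L))"
    using br_jacobi[OF P(1,2), of K] br_jacobi[OF P(1,2), of L] by (simp_all add: B_add B_psign)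
  \<comment> \<open>These terms stem from the exchange of I and J in the second derivative and are
    brought into the form of their counterparts.\<close>
  have flip: "B (br J L) (br I K) = psign ((j + n) * (i + l)) * B (br I K) (br J L)"
    "B (br J I) (br K L) = - psign (i * j) * B (br I J) (br K L)"
    "B (br J (mpart k m (br I K))) L = - psign (j * (i + l)) * B (br (mpart k m (br I K)) J) L"
  proof -
    show "B (br J L) (br I K) = psign ((j + n) * (i + l)) * B (br I K) (br J L)"
      using B_super_sym[OF br_in[OF P(2,4)] br_in[OF P(1,3)]] .
    show "B (br J I) (br K L) = - psign (i * j) * B (br I J) (br K L)"
      using br_super_skew[OF P(2,1)] by (cases i; cases j; simp add: B_minus)
    show "B (br J (mpart k m (br I K))) L = - psign (j * (i + l)) * B (br (mpart k m (br I K)) J) L"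
      using br_super_skew[OF P(2) mpart_in[OF br_in[OF P(1,3)]]] by (cases j; cases "i + l"; simp add: B_minus)
  qed
  have R: "4 * ?b (g W (curvature nab W i j (D I) (D J) (D K)) (D L))
      = - 2 * (2 * ?b (g W (nab W (D (br I J)) (D K)) (D L)))
        - 4 * ?b (g W (nab W (D I) (nab W (D J) (D K))) (D L))
        + psign (i * j) * (4 * ?b (g W (nab W (D J) (nab W (D I) (D K))) (D L)))"
    unfolding curv by simp
  show ?thesis
    unfolding brm_def B_mpart R kos nn jac flip
    by (cases i; cases j; cases l; cases n; simp only: sign_simps right_diff_distrib; linarith)
qed

end

text \<open>As \<open>Q\<close> is even and \<open>k\<close> is graded, an element orthogonal to
  \<open>k\<close> has both of its homogeneous components orthogonal to the homogeneous parts of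
  \<open>k\<close>, hence to \<open>k\<close>.\<close>

lemma orthogonal_complement_graded:
  assumes P: "super_vector_space scaleR P" and k: "graded_subspace scaleR P k"
    and Q: "invariant_form cx_scale (cx_part P) br Q" and m: "orthogonal_complement Q k m"
  shows "graded_subspace scaleR P m"
proof -
  have sub: "subspace (P a)" for a
    using P unfolding super_vector_space_def subspace_raw_def by blast
  have lin: "Vector_Spaces.linear cx_scale (*) (Q z)" "Vector_Spaces.linear cx_scale (*) (\<lambda>z. Q z w)"
    and even: "a \<noteq> b \<Longrightarrow> z \<in> cx_part P a \<Longrightarrow> w \<in> cx_part P b \<Longrightarrow> Q z w = 0" for a b z w
    using Q[unfolded invariant_form_def, THEN conjunct1]
      Q[unfolded invariant_form_def, THEN conjunct2, THEN conjunct1]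
      Q[unfolded invariant_form_def, THEN conjunct2, THEN conjunct2, THEN conjunct1] by blast+
  note hom = lin[folded module_hom_iff_linear]
  have Q_add: "Q (X + Y, 0) (Z, 0) = Q (X, 0) (Z, 0) + Q (Y, 0) (Z, 0)"
    "Q (Z, 0) (X + Y, 0) = Q (Z, 0) (X, 0) + Q (Z, 0) (Y, 0)" for X Y Z
    using module_hom.add[OF hom(2), of "(X, 0)" "(Y, 0)"] module_hom.add[OF hom(1), of "(Z, 0)" "(X, 0)" "(Y, 0)"]
    by simp_all
  \<comment> \<open>On elements with zero imaginary part, real scaling is complex scaling by a real
    number, so complex linearity of \<open>Q\<close> applies.\<close>
  have Q_scale: "Q (r *\<^sub>R X, 0) (Z, 0) = of_real r * Q (X, 0) (Z, 0)" for r X Z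
    using module_hom.scale[OF hom(2), of "of_real r" "(X, 0)"] by (simp add: cx_scale_def)
  have Q_even: "Q (X, 0) (Y, 0) = 0" if "X \<in> P a" "Y \<in> P b" "a \<noteq> b" for X Y a b
    using even[OF that(3)] that subspace_0[OF sub] by (simp add: cx_part_def)
  have m_iff: "X \<in> m \<longleftrightarrow> (\<forall>Y\<in>k. Q (X, 0) (Y, 0) = 0)" for X
    using m unfolding orthogonal_complement_def by blast
  have "Q (0, 0) (Y, 0) = 0" for Y
    using Q_scale[of 0 0 Y] by simp
  then have "subspace m"
    by (auto simp: subspace_def m_iff Q_add Q_scale)
  moreover have "\<exists>Y\<in>m \<inter> P 0. \<exists>Z\<in>m \<inter> P 1. X = Y + Z" if X: "X \<in> m" for X
  proof -
    obtain X0 X1 where X01: "X = X0 + X1" "X0 \<in> P 0" "X1 \<in> P 1"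
      using P unfolding super_vector_space_def by metis
    have "Q (X0, 0) (Y, 0) = 0 \<and> Q (X1, 0) (Y, 0) = 0" if "Y \<in> k" for Y
    proof -
      obtain Y0 Y1 where Y: "Y = Y0 + Y1" "Y0 \<in> k" "Y0 \<in> P 0" "Y1 \<in> k" "Y1 \<in> P 1"
        using k \<open>Y \<in> k\<close> unfolding graded_subspace_def by (metis IntE)
      have "Q (X0, 0) (Y0, 0) + Q (X1, 0) (Y0, 0) = 0" "Q (X0, 0) (Y1, 0) + Q (X1, 0) (Y1, 0) = 0"
        using X Y(2,4) unfolding X01(1) m_iff by (simp_all add: Q_add)
      then show ?thesis
        using Q_even[OF X01(2) Y(5)] Q_even[OF X01(3) Y(3)] by (simp add: Y(1) Q_add)
    qed
    then show ?thesis
      using X01 m_iff by blast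
  qed
  ultimately show ?thesis
    by (simp add: graded_subspace_def subspace_raw_def)
qed

theorem proposition3p12:
  fixes G :: "('g, 'a::real_vector) supergroup"
    and K\<^sub>0 :: "'g set" and k m :: "'a set"
    and M :: "('g set, 's::real_algebra) superspace"
    and pull :: "'g \<Rightarrow> 'g set set \<Rightarrow> 's \<Rightarrow> 's"
    and dag :: "'a \<Rightarrow> ('g set, 's) vfield"
    and Q :: "'a \<times> 'a \<Rightarrow> 'a \<times> 'a \<Rightarrow> complex"
    and g :: "('g set, 's) metric"
    and nab :: "('g set, 's) conn"
    and U :: "'a \<Rightarrow> 'a \<Rightarrow> 'a"
    and Xi Xj Xk Xl :: 'a
    and i j k' l :: bit
    and W :: "'g set set"
    and Yi Yj Yk Yl :: "('g set, 's) vfield"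
  assumes "lie_supergroup G" and "connected_space (gtop (grp G))"
    and "basic_classical cx_scale (cx_part (gpart G)) (cx_bracket (bracket G))"
    and "compact_even_part (gpart G) (bracket G)"
    and "closed_subsupergroup G K\<^sub>0 k" and "connectedin (gtop (grp G)) K\<^sub>0"
    and "homogeneous_superspace G K\<^sub>0 k M pull dag"
    and "graded_riemannian_metric M g" and "invariant_metric G M pull dag g"
    and "levi_civita M g nab"
    and "invariant_form cx_scale (cx_part (gpart G)) (cx_bracket (bracket G)) Q"
    and "orthogonal_complement Q k m"
    and "U_map G k m (scalar_superproduct M g dag K\<^sub>0) U"
    and "Xi \<in> m \<inter> gpart G i" and "Xj \<in> m \<inter> gpart G j"
    and "Xk \<in> m \<inter> gpart G k'" and "Xl \<in> m \<inter> gpart G l"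
    and "openin (base M) W" and "K\<^sub>0 \<in> W"
    and "Yi \<in> vf M W i" and "value_at M W Yi K\<^sub>0 = value_at M (topspace (base M)) (dag Xi) K\<^sub>0"
    and "Yj \<in> vf M W j" and "value_at M W Yj K\<^sub>0 = value_at M (topspace (base M)) (dag Xj) K\<^sub>0"
    and "Yk \<in> vf M W k'" and "value_at M W Yk K\<^sub>0 = value_at M (topspace (base M)) (dag Xk) K\<^sub>0"
    and "Yl \<in> vf M W l" and "value_at M W Yl K\<^sub>0 = value_at M (topspace (base M)) (dag Xl) K\<^sub>0"
  shows "let ip = scalar_superproduct M g dag K\<^sub>0;
             br = bracket G;
             brm = (\<lambda>X Y. mpart k m (bracket G X Y))
         in 4 * body M W (g W (curvature nab W i j Yi Yj Yk) Yl) K\<^sub>0 =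
             - 2 * ip (brm Xi Xj) (brm Xk Xl)
             + psign (i * (j + k')) * ip (brm Xj Xk) (brm Xi Xl)
             - psign (j * k') * ip (brm Xi Xk) (brm Xj Xl)
             - ip Xi (brm (brm Xj Xk) Xl)
             + ip (brm Xi (brm Xj Xk)) Xl
             + psign (i * j) * ip Xj (brm (brm Xi Xk) Xl)
             + psign (j * k') * ip (brm (brm Xi Xk) Xj) Xl
             + psign (i * (j + k')) * ip Xj (brm Xk (brm Xi Xl))
             + psign (i * j + k' * l) * ip (brm Xj (brm Xi Xl)) Xk
             - psign (j * k') * ip Xi (brm Xk (brm Xj Xl))
             - psign (k' * l) * ip (brm Xi (brm Xj Xl)) Xk
             + 2 * ip Xi (brm Xj (br Xk Xl))
             - 2 * psign (i * j) * ip Xj (brm Xi (br Xk Xl))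
             + psign (i * (j + k')) * ip (U Xj Xk) (U Xi Xl)
             - psign (j * k') * ip (U Xi Xk) (U Xj Xl)"
proof -
  obtain p q where M: "supermanifold M p q" and act: "infinitesimal_action G M p q pull dag"
    using assms(7) unfolding homogeneous_superspace_def by blast
  let ?o = "K\<^sub>0" and ?top = "topspace (base M)"
  have lie: "lie_superalgebra scaleR (gpart G) (bracket G)"
    using assms(1) unfolding lie_supergroup_def by (elim conjE)
  have k: "graded_subspace scaleR (gpart G) k"
    using assms(5) unfolding closed_subsupergroup_def by (elim conjE)
  have m: "graded_subspace scaleR (gpart G) m"
    using orthogonal_complement_graded[OF _ k assms(11,12)] lie unfolding lie_superalgebra_def by blast
  note act_parts = act[unfolded infinitesimal_action_def]
  have transitive: "range (\<lambda>X. value_at M ?top (dag X) ?o) = tangent_space M ?o"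
    and stabiliser: "{X. value_at M ?top (dag X) ?o = (\<lambda>V f. 0)} = k"
    using assms(7)[unfolded homogeneous_superspace_def] by simp_all
  interpret killing_fields M p q g nab W "K\<^sub>0" "gpart G" "bracket G" dag k
  proof unfold_locales
    show "supermanifold M p q" "graded_riemannian_metric M g" "levi_civita M g nab"
      "openin (base M) W" "K\<^sub>0 \<in> W"
      using M assms(8,10,18,19) by auto
    show "lie_superalgebra scaleR (gpart G) (bracket G)"
      by (rule lie)
    show "dag X \<in> vf M ?top a" if "X \<in> gpart G a" for X a
      using act_parts[THEN conjunct1] that by blast
    show "dag (X + Y) = vadd (dag X) (dag Y)" for X Y
      using act_parts[THEN conjunct2, THEN conjunct1] by blast
    show "dag (r *\<^sub>R X) = vscale r (dag X)" for r X
      using act_parts[THEN conjunct2, THEN conjunct2, THEN conjunct1] by blast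
    show "vbracket a b (dag X) (dag Y) = vscale (- 1) (dag (bracket G X Y))"
      if "X \<in> gpart G a" "Y \<in> gpart G b" for X Y a b
      using act_parts[THEN conjunct2, THEN conjunct2, THEN conjunct2, THEN conjunct1] that by blast
    show "dag X W (g W \<eta> \<zeta>) = g W (vbracket a b (vres (dag X) W) \<eta>) \<zeta>
        + psign (a * b) *\<^sub>R g W \<eta> (vbracket a c (vres (dag X) W) \<zeta>)"
      if "X \<in> gpart G a" "\<eta> \<in> vf M W b" "\<zeta> \<in> vf M W c" for X \<eta> \<zeta> a b c
      using assms(9)[unfolded invariant_metric_def, THEN conjunct2, THEN spec, THEN spec, THEN spec,
          THEN spec, THEN mp, OF assms(18)] that by blast
    show "tangent_space M ?o \<subseteq> range (\<lambda>X. value_at M ?top (dag X) ?o)"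
      using transitive by simp
    show "value_at M ?top (dag A) ?o = (\<lambda>V f. 0)" if "A \<in> k" for A
      using stabiliser that by blast
  qed
  have U: "U X Y \<in> m \<inter> gpart G (a + b)"
    "\<And>Z. Z \<in> m \<Longrightarrow> B (U X Y) Z
      = - B X (mpart k m (bracket G Y Z)) - psign (a * b) * B Y (mpart k m (bracket G X Z))"
    if "X \<in> m \<inter> gpart G a" "Y \<in> m \<inter> gpart G b" for X Y a b
    using assms(13) that unfolding U_map_def scalar_superproduct_B by blast+
  interpret complemented_killing_fields M p q g nab W "K\<^sub>0" "gpart G" "bracket G" dag k m U
  proof unfold_locales
    show "graded_subspace scaleR (gpart G) k" "graded_subspace scaleR (gpart G) m"
      by (rule k, rule m)
    note km = assms(12)[unfolded orthogonal_complement_def, THEN conjunct2]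
    show "k \<inter> m = {0}"
      by (rule km[THEN conjunct1])
    show "\<exists>Y\<in>k. \<exists>Z\<in>m. X = Y + Z" for X
      by (rule km[THEN conjunct2, THEN spec])
  qed (fact U)+
  have P: "Xi \<in> gpart G i" "Xj \<in> gpart G j" "Xk \<in> gpart G k'" "Xl \<in> gpart G l"
    using assms(14-17) by auto
  have "Rm (i, Yi) (j, Yj) (k', Yk) (l, Yl) = Rm (i, D Xi) (j, D Xj) (k', D Xk) (l, D Xl)"
    by (rule Rm_cong) (simp_all add: D_vf P D_value assms(20-27))
  then have "body M W (g W (curvature nab W i j Yi Yj Yk) Yl) K\<^sub>0
      = body M W (g W (curvature nab W i j (D Xi) (D Xj) (D Xk)) (D Xl)) K\<^sub>0"
    by (simp add: Rm_def)
  then show ?thesis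
    unfolding Let_def scalar_superproduct_B
    using curvature_at_base_point[OF assms(14-17)] by (simp only:)
qed

end
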